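(* Let $G$ be a connected simple graph of order $n>10$ and let $k$ be an integer with $2 \le k \le n-2$. Then $F_k(G)$ is planar if and only if ($k=2$ or $k=n-2$) and $G$ is isomorphic to the path $P_n$ on $n$ vertices.
   Context: For a simple graph $G=(V,E)$ on $n$ vertices and an integer $1\le k<n$, the $k$-token graph $F_k(G)$ is the graph whose vertices are all $k$-element subsets of $V$, two such subsets $A,B$ being adjacent whenever their symmetric difference $A\triangle B$ is a pair $\{a,b\}$ with $a$ adjacent to $b$ in $G$. *)

theory Defs
  imports "HOL-Analysis.Analysis"
begin

text \<open>A finite simple graph is given by a vertex set V and an edge set E of
  2-element subsets of V.\<close>

definition simple_graph :: "'a set \<Rightarrow> 'a set set \<Rightarrow> bool" where
  "simple_graph V E \<longleftrightarrow> finite V \<and> (\<forall>e\<in>E. e \<subseteq> V \<and> card e = 2)"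

definition connected_graph :: "'a set \<Rightarrow> 'a set set \<Rightarrow> bool" where
  "connected_graph V E \<longleftrightarrow> V \<noteq> {} \<and>
     (\<forall>u\<in>V. \<forall>v\<in>V. (u, v) \<in> {(x, y). {x, y} \<in> E}\<^sup>*)"

text \<open>The k-token graph: vertices are k-subsets of V; A, B adjacent iff
  their symmetric difference is an edge {a,b} of G.\<close>

definition token_vertices :: "'a set \<Rightarrow> nat \<Rightarrow> 'a set set" where
  "token_vertices V k = {A. A \<subseteq> V \<and> card A = k}"

definition token_edges :: "'a set \<Rightarrow> 'a set set \<Rightarrow> nat \<Rightarrow> 'a set set set" where
  "token_edges V E k = {{A, B} | A B. A \<in> token_vertices V k \<and> B \<in> token_vertices V k \<and>
      (\<exists>a b. (A - B) \<union> (B - A) = {a, b} \<and> {a, b} \<in> E)}"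

text \<open>Path graph P_n on vertices 0..n-1.\<close>

definition path_vertices :: "nat \<Rightarrow> nat set" where
  "path_vertices n = {0..<n}"

definition path_edges :: "nat \<Rightarrow> nat set set" where
  "path_edges n = {{i, Suc i} | i. Suc i < n}"

definition graph_iso :: "'a set \<Rightarrow> 'a set set \<Rightarrow> 'b set \<Rightarrow> 'b set set \<Rightarrow> bool" where
  "graph_iso V E W F \<longleftrightarrow> (\<exists>f. bij_betw f V W \<and>
      (\<forall>u\<in>V. \<forall>v\<in>V. {u, v} \<in> E \<longleftrightarrow> {f u, f v} \<in> F))"

text \<open>Planarity: an embedding in the plane (identified with the complex
  plane) sending vertices to distinct points and edges to arcs joining the
  images of their endpoints, such that an arc meets no vertex image other than
  its endpoints and two distinct arcs meet only in images of common endpoints.\<close>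

definition planar_graph :: "'a set \<Rightarrow> 'a set set \<Rightarrow> bool" where
  "planar_graph V E \<longleftrightarrow> (\<exists>(f :: 'a \<Rightarrow> complex) (g :: 'a set \<Rightarrow> real \<Rightarrow> complex).
      inj_on f V \<and>
      (\<forall>e\<in>E. arc (g e) \<and> {pathstart (g e), pathfinish (g e)} = f ` e \<and>
              path_image (g e) \<inter> f ` V = f ` e) \<and>
      (\<forall>e\<in>E. \<forall>e'\<in>E. e \<noteq> e' \<longrightarrow> path_image (g e) \<inter> path_image (g e') = f ` (e \<inter> e')))"

end

theory Submission
  imports Defs
begin

text \<open>
  Every non-planarity claim reduces to one topological fact: a graph drawn in the plane has no
  $K_{3,3}$ minor. Its core is that the three arcs of a theta curve cannot all border one face,
  which follows from the theta-curve supplement of the Jordan curve theorem.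

  If $H$ is a minor of $G$, then $F_l(H)$ is a minor of $F_k(G)$ whenever $k - l$ tokens can be parked
  outside the branch sets. By complementation one may assume $2k \le n$, so up to eight vertices
  of $G$ may be used for $l = 2$. Suppose $G$ has a vertex of degree at least three, and take a
  three-legged spider of maximal size in $G$. Either it has a leg of length at least four, or a further
  vertex is attached to it, at the centre or inside a leg. Each case yields a small tree $T$, a minor
  of $G$, for which $F_2(T)$ has a $K_{3,3}$ minor. Otherwise $G$ is a path or a cycle; $F_2(C_6)$ and
  $F_3(P_7)$ have $K_{3,3}$ minors,
  while $F_2(P_n)$ is part of the square grid.
\<close>

section \<open>Arcs and theta curves\<close>

text \<open>The obstacle is that a minor cannot simply be contracted inside a drawing: a branch set
  occupies a path-connected region of unknown shape. So no region is ever shrunk. Two regions on one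
  side of K_{3,3} each yield a tripod; the two branching points become the poles of a theta curve
  whose arcs run through the three regions of the other side, and the remaining region grows feelers
  that touch all three arcs. With K_{3,3} as the only obstruction the topology is reduced to this
  one configuration; the price is that graphs whose two-token graph is merely a subdivided K_5 must
  be enlarged by a vertex. The bound n > 10 enters twice. A spider with legs of length at most three
  has at most 1 + 3 + 3 + 3 = 10 vertices, so some vertex lies outside it. And from 2l <= n and n >=
  11 follows l + 6 <= n, exactly the room needed to park l - 2 tokens beside branch sets with eight
  vertices in total.\<close>

lemma path_connected_first_hit:
  fixes S :: "'a::t2_space set"
  assumes "path_connected S" "closed C" "z \<in> S" "z \<notin> C" "S \<inter> C \<noteq> {}"
  obtains a T where "compact T" "path_connected T" "z \<in> T" "T \<subseteq> S" "T \<inter> C = {a}" "connected (T - {a})"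
proof -
  obtain b where b: "b \<in> S" "b \<in> C" using assms by blast
  obtain g where g: "path g" "path_image g \<subseteq> S" "pathstart g = z" "pathfinish g = b"
    using assms(1,3) b unfolding path_connected_def by blast
  have cont: "continuous_on {0..1} g" using g(1) by (simp add: path_def)
  define K where "K = {t \<in> {0..1}. g t \<in> C}"
  have "closed K"
    unfolding K_def using continuous_closed_preimage[OF cont _ assms(2)]
    by (simp add: vimage_def Int_def)
  then have "compact K"
    unfolding compact_eq_bounded_closed
    by (auto intro: bounded_subset[OF bounded_closed_interval[of 0 1]] simp: K_def)
  moreover have "1 \<in> K" using g(4) b by (auto simp: K_def pathfinish_def)
  ultimately obtain t where t: "t \<in> K" "\<And>s. s \<in> K \<Longrightarrow> t \<le> s"
    using compact_attains_inf[of K] by blast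
  have t01: "0 \<le> t" "t \<le> 1" "g t \<in> C" using t(1) by (auto simp: K_def)
  have before: "g s \<notin> C" if "0 \<le> s" "s < t" for s
    using t(2)[of s] that t01 by (force simp: K_def)
  \<comment> \<open>As \<open>t\<close> is the first time in \<open>C\<close>, deleting the endpoint
    leaves the image of a half-open interval, hence a connected set. This is what later allows the
    touching point of a feeler to be cut off.\<close>
  have eq: "g ` {0..t} - {g t} = g ` {0..<t}"
    using before t01 by (force simp: less_le)
  show ?thesis
  proof
    have c': "continuous_on {0..t} g" "continuous_on {0..<t} g"
      using cont t01 by (auto elim!: continuous_on_subset)
    show "compact (g ` {0..t})" using c' by (intro compact_continuous_image) auto
    show "path_connected (g ` {0..t})" using c' by (intro path_connected_continuous_image) auto
    show "z \<in> g ` {0..t}" using g(3) t01 by (auto simp: pathstart_def)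
    show "g ` {0..t} \<subseteq> S" using g(2) t01 by (auto simp: path_image_def)
    show "g ` {0..t} \<inter> C = {g t}" using before t01 by (force simp: less_le)
    show "connected (g ` {0..t} - {g t})"
      unfolding eq using c' by (intro connected_continuous_image) auto
  qed
qed

lemma connected_subset_inside:
  assumes "connected K" "K \<inter> J = {}" "K \<inter> inside J \<noteq> {}"
  shows "K \<subseteq> inside J"
proof
  fix y assume y: "y \<in> K"
  obtain x where x: "x \<in> K" "x \<in> inside J" using assms(3) by blast
  have "connected_component (- J) x y"
    unfolding connected_component_def using assms(1,2) x y by blast
  then show "y \<in> inside J" using x(2) inside_same_component by blast
qed

lemma connected_insert_Un:
  assumes "connected (insert a Y)" "connected D" "a \<in> D"
  shows "connected (Y \<union> D)"
proof -
  have "Y \<union> D = insert a Y \<union> D" using assms(3) by blast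
  then show ?thesis using connected_Un[OF assms(1,2)] assms(3) by auto
qed

text \<open>\<open>Y\<close> misses the theta curve, and connectedness of \<open>insert a1 Y\<close>
  says that it nevertheless reaches the interior of the first arc. The third arc cuts the inside of
  the other two into the insides of \<open>c1\<close>, \<open>c3\<close> and of \<open>c2\<close>,
  \<open>c3\<close>. Since \<open>Y\<close> is tied to the third arc, it lies in one of these
  pieces. The remaining arc, tied to \<open>Y\<close> as well, is then dragged into that piece,
  although it lies on the outer curve.\<close>

lemma theta_inside:
  fixes c1 c2 c3 :: "real \<Rightarrow> complex"
  assumes c: "simple_path c1" "pathstart c1 = u" "pathfinish c1 = v"
      "simple_path c2" "pathstart c2 = u" "pathfinish c2 = v"
      "simple_path c3" "pathstart c3 = u" "pathfinish c3 = v"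
    and uv: "u \<noteq> v"
    and int: "path_image c1 \<inter> path_image c2 = {u, v}" "path_image c1 \<inter> path_image c3 = {u, v}"
      "path_image c2 \<inter> path_image c3 = {u, v}"
    and Y: "Y \<noteq> {}" "Y \<inter> (path_image c1 \<union> path_image c2 \<union> path_image c3) = {}"
    and a: "a1 \<in> path_image c1 - {u, v}" "a2 \<in> path_image c2 - {u, v}" "a3 \<in> path_image c3 - {u, v}"
    and Ya: "connected (insert a1 Y)" "connected (insert a2 Y)" "connected (insert a3 Y)"
    and ne: "path_image c3 \<inter> inside (path_image c1 \<union> path_image c2) \<noteq> {}"
  shows False
proof -
  let ?D1 = "path_image c1 - {u, v}" and ?D2 = "path_image c2 - {u, v}" and ?D3 = "path_image c3 - {u, v}"
  have D: "connected ?D1" "connected ?D2" "connected ?D3"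
    using connected_simple_path_endless[OF c(1)] connected_simple_path_endless[OF c(4)]
      connected_simple_path_endless[OF c(7)] c by auto
  have K: "connected (Y \<union> ?D1)" "connected (Y \<union> ?D2)" "connected (Y \<union> ?D3)"
    by (rule connected_insert_Un[OF Ya(1) D(1) a(1)] connected_insert_Un[OF Ya(2) D(2) a(2)]
        connected_insert_Un[OF Ya(3) D(3) a(3)])+
  let ?J = "path_image c1 \<union> path_image c2"
  have noJ: "inside S \<inter> S = {}" for S :: "complex set" by (rule inside_no_overlap)
  have "(Y \<union> ?D3) \<inter> inside ?J \<noteq> {}"
  proof -
    obtain x where x: "x \<in> path_image c3" "x \<in> inside ?J" using ne by blast
    have "u \<in> ?J" "v \<in> ?J" using int(1) by auto
    then have "x \<noteq> u" "x \<noteq> v" using x noJ[of ?J] by blast+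
    then show ?thesis using x by blast
  qed
  moreover have "(Y \<union> ?D3) \<inter> ?J = {}" using Y int by blast
  ultimately have YJ: "Y \<subseteq> inside ?J" using connected_subset_inside[OF K(3)] by blast
  obtain
    split: "inside (path_image c1 \<union> path_image c3) \<union> inside (path_image c2 \<union> path_image c3) \<union>
      (path_image c3 - {u, v}) = inside ?J"
    by (rule split_inside_simple_closed_curve[OF c uv int ne])
  obtain y where y: "y \<in> Y" using Y by blast
  then have "y \<in> inside (path_image c1 \<union> path_image c3) \<or> y \<in> inside (path_image c2 \<union> path_image c3)"
    using split YJ Y(2) by blast
  then show False
  proof
    assume "y \<in> inside (path_image c1 \<union> path_image c3)"
    then have "Y \<union> ?D2 \<subseteq> inside (path_image c1 \<union> path_image c3)"
      using y Y int by (intro connected_subset_inside[OF K(2)]) blast+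
    then have "a2 \<in> inside ?J" using split a by blast
    then show False using a noJ[of ?J] by blast
  next
    assume "y \<in> inside (path_image c2 \<union> path_image c3)"
    then have "Y \<union> ?D1 \<subseteq> inside (path_image c2 \<union> path_image c3)"
      using y Y int by (intro connected_subset_inside[OF K(1)]) blast+
    then have "a1 \<in> inside ?J" using split a by blast
    then show False using a noJ[of ?J] by blast
  qed
qed

lemma Jordan_theta:
  fixes c1 c2 :: "real \<Rightarrow> complex"
  assumes c: "simple_path c1" "pathstart c1 = u" "pathfinish c1 = v"
      "simple_path c2" "pathstart c2 = u" "pathfinish c2 = v"
    and uv: "u \<noteq> v"
    and int: "path_image c1 \<inter> path_image c2 = {u, v}"
  defines "J \<equiv> path_image c1 \<union> path_image c2"
  shows "compact J" "inside J \<noteq> {}" "open (inside J)" "connected (outside J)" "open (outside J)"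
    "\<not> bounded (outside J)" "inside J \<union> outside J = - J"
proof -
  let ?c = "c1 +++ reversepath c2"
  have arcs: "arc c1" "arc c2" using c uv by (auto simp: arc_simple_path)
  have "simple_path ?c"
    by (rule simple_path_join_loop) (use arcs c int in \<open>auto simp: arc_reversepath\<close>)
  moreover have "pathfinish ?c = pathstart ?c" using c by simp
  moreover have "path_image ?c = J" unfolding J_def using c by (subst path_image_join) auto
  ultimately show "inside J \<noteq> {}" "open (inside J)" "connected (outside J)" "open (outside J)"
    "\<not> bounded (outside J)" "inside J \<union> outside J = - J"
    using Jordan_inside_outside[of ?c] by auto
  show "compact J" unfolding J_def
    using arcs by (intro compact_Un compact_path_image) (auto simp: arc_imp_path)
qed

text \<open>What \<open>theta_inside\<close> leaves open is a third arc that avoids the inside of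
  the other two. The two sides of a Jordan curve are interchangeable on the sphere, and an inversion
  performs the exchange within the plane.\<close>

lemma theta_no_common_face:
  fixes c1 c2 c3 :: "real \<Rightarrow> complex"
  assumes c: "simple_path c1" "pathstart c1 = u" "pathfinish c1 = v"
      "simple_path c2" "pathstart c2 = u" "pathfinish c2 = v"
      "simple_path c3" "pathstart c3 = u" "pathfinish c3 = v"
    and uv: "u \<noteq> v"
    and int: "path_image c1 \<inter> path_image c2 = {u, v}" "path_image c1 \<inter> path_image c3 = {u, v}"
      "path_image c2 \<inter> path_image c3 = {u, v}"
    and Y: "Y \<noteq> {}" "Y \<inter> (path_image c1 \<union> path_image c2 \<union> path_image c3) = {}"
    and a: "a1 \<in> path_image c1 - {u, v}" "a2 \<in> path_image c2 - {u, v}" "a3 \<in> path_image c3 - {u, v}"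
    and Ya: "connected (insert a1 Y)" "connected (insert a2 Y)" "connected (insert a3 Y)"
  shows False
proof (cases "path_image c3 \<inter> inside (path_image c1 \<union> path_image c2) = {}")
  case False
  then show False using theta_inside[OF assms] by blast
next
  case True
  let ?J = "path_image c1 \<union> path_image c2"
  note J = Jordan_theta[OF c(1-6) uv int(1)]
  \<comment> \<open>The inversion about a point inside the first two arcs moves the third arc and Y to the inside.\<close>
  obtain q where q: "q \<in> inside ?J" using J(2) by blast
  let ?D3 = "path_image c3 - {u, v}"
  have D3: "connected ?D3" using connected_simple_path_endless[OF c(7)] c by auto
  have K3: "connected (Y \<union> ?D3)" by (rule connected_insert_Un[OF Ya(3) D3 a(3)])
  have K3J: "(Y \<union> ?D3) \<inter> ?J = {}" using Y int by blast
  have K3in: "(Y \<union> ?D3) \<inter> inside ?J = {}"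
    using connected_subset_inside[OF K3 K3J] True a(3) by blast
  \<comment> \<open>Because \<open>inverse 0 = 0\<close>, the two maps are mutually inverse on the
    whole plane, with \<open>q\<close> corresponding to 0. Only continuity at these two points has
    to be avoided.\<close>
  define h where "h z = inverse (z - q)" for z
  define k where "k w = q + inverse w" for w :: complex
  have kh: "k (h z) = z" for z by (simp add: h_def k_def)
  have hk: "h (k w) = w" for w by (simp add: h_def k_def)
  have injh: "inj_on h X" for X by (metis inj_onI kh)
  let ?T = "path_image c1 \<union> path_image c2 \<union> path_image c3 \<union> Y"
  have "q \<notin> ?T" using q K3in True inside_no_overlap[of ?J] by blast
  then have conth: "continuous_on ?T h"
    unfolding h_def by (intro continuous_intros) auto
  have hc: "simple_path (h \<circ> c')" "pathstart (h \<circ> c') = h u" "pathfinish (h \<circ> c') = h v"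
    if "c' \<in> {c1, c2, c3}" for c'
  proof -
    have "path_image c' \<subseteq> ?T" using that by auto
    then show "simple_path (h \<circ> c')"
      using that c injh conth by (intro simple_path_continuous_image) (auto elim: continuous_on_subset)
  qed (use that c in \<open>auto simp: pathstart_compose pathfinish_compose\<close>)
  have im: "h ` X \<inter> h ` X' = h ` (X \<inter> X')" for X X'
    by (rule image_Int[symmetric]) (use injh in simp)
  have huv: "h u \<noteq> h v" using uv kh by metis
  have hY: "connected (insert (h b) (h ` Y))" if "connected (insert b Y)" "b \<in> ?T" for b
  proof -
    have "connected (h ` insert b Y)"
      using that by (intro connected_continuous_image continuous_on_subset[OF conth]) auto
    then show ?thesis by simp
  qed
  have ha: "h b \<in> path_image (h \<circ> c') - {h u, h v}" if "b \<in> path_image c' - {u, v}" for b c'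
    using that kh by (auto simp: path_image_compose) metis+
  let ?J' = "path_image (h \<circ> c1) \<union> path_image (h \<circ> c2)"
  have J'eq: "?J' = h ` ?J" by (simp add: path_image_compose image_Un)
  have int': "path_image (h \<circ> c1) \<inter> path_image (h \<circ> c2) = {h u, h v}"
    "path_image (h \<circ> c1) \<inter> path_image (h \<circ> c3) = {h u, h v}"
    "path_image (h \<circ> c2) \<inter> path_image (h \<circ> c3) = {h u, h v}"
    using int by (simp_all add: path_image_compose im)
  have m: "c1 \<in> {c1, c2, c3}" "c2 \<in> {c1, c2, c3}" "c3 \<in> {c1, c2, c3}" by simp_all
  note J' = Jordan_theta[OF hc[OF m(1)] hc[OF m(2)] huv int'(1)]
  have ne: "path_image (h \<circ> c3) \<inter> inside ?J' \<noteq> {}"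
  proof
    assume emp: "path_image (h \<circ> c3) \<inter> inside ?J' = {}"
    \<comment> \<open>\<open>M\<close> is the outside of the new curve pulled back, without the
      point 0 at which \<open>k\<close> is not continuous. It is connected, misses the old curve and
      contains \<open>a3\<close>, so it avoids the old inside. But points far out in the unbounded
      outside are pulled back close to \<open>q\<close>, which lies in the old inside.\<close>
    define M where "M = k ` (outside ?J' - {0})"
    have "connected (outside ?J' - {0})"
      using J' by (intro connected_open_delete) auto
    then have conM: "connected M"
      unfolding M_def k_def by (intro connected_continuous_image continuous_intros) auto
    have MJ: "M \<inter> ?J = {}"
    proof -
      have "k w \<notin> ?J" if "w \<in> outside ?J'" for w
      proof
        assume "k w \<in> ?J"
        then have "h (k w) \<in> ?J'" unfolding J'eq by (rule imageI)
        then show False using that hk[of w] outside_no_overlap[of ?J'] by (metis disjoint_iff)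
      qed
      then show ?thesis unfolding M_def by blast
    qed
    have "h a3 \<in> outside ?J'"
    proof -
      have "h a3 \<in> path_image (h \<circ> c3) - {h u, h v}" by (rule ha[OF a(3)])
      then have "h a3 \<notin> inside ?J'" "h a3 \<notin> ?J'" using emp int' by blast+
      then show ?thesis using J'(7) by blast
    qed
    moreover have "h a3 \<noteq> 0"
      using \<open>q \<notin> ?T\<close> a(3) by (auto simp: h_def)
    ultimately have "a3 \<in> M" unfolding M_def by (intro image_eqI[of _ _ "h a3"]) (auto simp: kh)
    then have "\<not> M \<subseteq> inside ?J" using K3in a(3) by blast
    then have Min: "M \<inter> inside ?J = {}"
      using connected_subset_inside[OF conM MJ] by blast
    obtain e where e: "e > 0" "ball q e \<subseteq> inside ?J" using J(3) q openE by blast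
    obtain w where w: "w \<in> outside ?J'" "norm w > 1 / e"
      using J'(6) unfolding bounded_iff by (metis not_le)
    have w0: "norm w > 0" using w(2) e(1) by (meson divide_pos_pos less_trans zero_less_one)
    have "norm (inverse w) < e" using w(2) w0 e(1) unfolding norm_inverse by (simp add: field_simps)
    then have "k w \<in> ball q e" by (simp add: k_def dist_norm)
    moreover have "k w \<in> M" unfolding M_def using w w0 by auto
    ultimately show False using e(2) Min by blast
  qed
  have Y': "h ` Y \<noteq> {}" "h ` Y \<inter> (path_image (h \<circ> c1) \<union> path_image (h \<circ> c2) \<union> path_image (h \<circ> c3)) = {}"
    using Y(1) unfolding path_image_compose image_Un[symmetric] im Y(2) by simp_all
  have a': "a1 \<in> ?T" "a2 \<in> ?T" "a3 \<in> ?T" using a by blast+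
  note hY' = hY[OF Ya(1) a'(1)] hY[OF Ya(2) a'(2)] hY[OF Ya(3) a'(3)]
  note ha' = ha[OF a(1)] ha[OF a(2)] ha[OF a(3)]
  note hc' = hc[OF m(1)] hc[OF m(2)] hc[OF m(3)]
  show False
    by (rule theta_inside[where Y = "h ` Y", OF hc' huv int' Y' ha' hY' ne])
qed

section \<open>Path-connected regions joined like $K_{3,3}$\<close>

lemma connected_Int_nonempty_if_closed_cover:
  assumes "connected S" "closed P" "closed Q" "S \<subseteq> P \<union> Q \<union> B" "P \<inter> Q \<subseteq> B"
    "S \<inter> P \<noteq> {}" "S \<inter> Q \<noteq> {}"
  shows "S \<inter> B \<noteq> {}"
proof
  assume "S \<inter> B = {}"
  then have "P \<inter> Q \<inter> S = {}" "S \<subseteq> P \<union> Q" using assms by blast+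
  then show False using assms connected_closed[of S] by blast
qed

lemma path_connected_Un_arc:
  assumes "path_connected B" "arc e" "pathfinish e \<in> B"
  shows "path_connected (B \<union> path_image e)"
  using assms
  by (intro path_connected_Un path_connected_path_image arc_imp_path) (use pathfinish_in_path_image in blast)+

text \<open>The substitute for contracting \<open>B\<close> to a point: inside \<open>B\<close> and
  three arcs ending in it, there are three legs that meet only in a branching point
  \<open>u\<close>. An arc \<open>c\<close> joins two of the feet, and a path from the third foot is
  stopped where it first hits \<open>c\<close>. The legs are only compact and path-connected, since
  arcs are chosen afterwards inside larger unions.\<close>

lemma tripod:
  fixes e1 e2 e3 :: "real \<Rightarrow> 'a::euclidean_space"
  assumes B: "path_connected B"
    and arcs: "arc e1" "arc e2" "arc e3"
    and start: "pathstart e1 \<notin> B" "pathstart e2 \<notin> B" "pathstart e3 \<notin> B"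
    and fin: "pathfinish e1 \<in> B" "pathfinish e2 \<in> B" "pathfinish e3 \<in> B"
    and int: "path_image e1 \<inter> path_image e2 \<subseteq> B" "path_image e1 \<inter> path_image e3 \<subseteq> B"
      "path_image e2 \<inter> path_image e3 \<subseteq> B"
  obtains u T1 T2 T3 where
    "compact T1" "path_connected T1" "u \<in> T1" "pathstart e1 \<in> T1"
    "compact T2" "path_connected T2" "u \<in> T2" "pathstart e2 \<in> T2"
    "compact T3" "path_connected T3" "u \<in> T3" "pathstart e3 \<in> T3"
    "T1 \<inter> T2 = {u}" "T1 \<inter> T3 = {u}" "T2 \<inter> T3 = {u}"
    "T1 \<union> T2 \<union> T3 \<subseteq> B \<union> path_image e1 \<union> path_image e2 \<union> path_image e3"
    "u \<notin> {pathstart e1, pathstart e2, pathstart e3}"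
proof -
  note si = pathstart_in_path_image[of e1] pathstart_in_path_image[of e2] pathstart_in_path_image[of e3]
  let ?S = "B \<union> path_image e2 \<union> path_image e3" and ?R = "B \<union> path_image e1"
  have "path_connected ?S"
    using B arcs fin by (intro path_connected_Un_arc) auto
  moreover have "pathstart e2 \<noteq> pathstart e3" using int start si by auto
  ultimately obtain c where c: "arc c" "path_image c \<subseteq> ?S" "pathstart c = pathstart e2" "pathfinish c = pathstart e3"
    using si unfolding path_connected_arcwise by blast
  have ends: "pathstart e2 \<in> path_image c" "pathstart e3 \<in> path_image c"
    using c pathstart_in_path_image pathfinish_in_path_image by metis+
  \<comment> \<open>Outside \<open>B\<close> the arc \<open>c\<close> can only run in the images of
    \<open>e2\<close> and \<open>e3\<close>, two closed sets that are disjoint there; so it has to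
    pass through \<open>B\<close> on its way from one to the other.\<close>
  have "path_image c \<inter> B \<noteq> {}"
    by (rule connected_Int_nonempty_if_closed_cover[of _ "path_image e2" "path_image e3"])
      (use c ends si int arcs in \<open>auto simp: connected_arc_image closed_arc_image\<close>)
  then have hit: "?R \<inter> path_image c \<noteq> {}" by blast
  have "path_connected ?R" by (rule path_connected_Un_arc[OF B arcs(1) fin(1)])
  moreover have "pathstart e1 \<notin> path_image c" using c(2) int start si by blast
  moreover have "closed (path_image c)" using c by (simp add: closed_arc_image)
  ultimately obtain u T where T: "compact T" "path_connected T" "pathstart e1 \<in> T" "T \<subseteq> ?R"
      "T \<inter> path_image c = {u}"
    using path_connected_first_hit[of ?R "path_image c" "pathstart e1"] hit si by (metis UnCI)
  obtain s where s: "s \<in> {0..1}" "u = c s" using T(5) unfolding path_image_def by blast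
  let ?T2 = "c ` {0..s}" and ?T3 = "c ` {s..1}"
  have sub: "?T2 \<subseteq> path_image c" "?T3 \<subseteq> path_image c" using s by (auto simp: path_image_def)
  have cont: "continuous_on {0..s} c" "continuous_on {s..1} c"
    using c(1) s by (auto simp: arc_def path_def elim!: continuous_on_subset)
  show ?thesis
  proof (rule that[of T u ?T2 ?T3])
    show "compact ?T2" "compact ?T3" "path_connected ?T2" "path_connected ?T3"
      using cont by (auto intro!: compact_continuous_image path_connected_continuous_image)
    show "u \<in> T" using T by blast
    show "u \<in> ?T2" "u \<in> ?T3" using s by auto
    have "c 0 \<in> ?T2" "c 1 \<in> ?T3" using s by auto
    then show "pathstart e2 \<in> ?T2" "pathstart e3 \<in> ?T3"
      using c(3,4) by (simp_all add: pathstart_def pathfinish_def)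
    show "T \<inter> ?T2 = {u}" "T \<inter> ?T3 = {u}" using T(5) sub \<open>u \<in> ?T2\<close> \<open>u \<in> ?T3\<close> by blast+
    have "?T2 \<inter> ?T3 = c ` ({0..s} \<inter> {s..1})"
      by (rule inj_on_image_Int[symmetric, of c "{0..1}"]) (use c(1) s in \<open>auto simp: arc_def\<close>)
    then show "?T2 \<inter> ?T3 = {u}" using s by auto
    show "T \<union> ?T2 \<union> ?T3 \<subseteq> B \<union> path_image e1 \<union> path_image e2 \<union> path_image e3"
      using T(4) sub c(2) by blast
    \<comment> \<open>\<open>?R\<close> and \<open>?S\<close> have only points of \<open>B\<close>
      in common, so \<open>u\<close> lies in \<open>B\<close>, whereas the three feet do
      not.\<close>
    have "u \<in> ?R" "u \<in> path_image c" using T by blast+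
    then show "u \<notin> {pathstart e1, pathstart e2, pathstart e3}"
      using int start si c(2) by blast
  qed (use T in auto)
qed

lemma tripod_indexed:
  fixes e :: "nat \<Rightarrow> real \<Rightarrow> 'a::euclidean_space"
  assumes B: "path_connected B"
    and arcs: "\<And>i. i < 3 \<Longrightarrow> arc (e i)"
    and start: "\<And>i. i < 3 \<Longrightarrow> pathstart (e i) \<notin> B"
    and fin: "\<And>i. i < 3 \<Longrightarrow> pathfinish (e i) \<in> B"
    and int: "\<And>i j. i < 3 \<Longrightarrow> j < 3 \<Longrightarrow> i \<noteq> j \<Longrightarrow> path_image (e i) \<inter> path_image (e j) \<subseteq> B"
  shows "\<exists>u T. (\<forall>i<3. compact (T i) \<and> path_connected (T i) \<and> u \<in> T i \<and> pathstart (e i) \<in> T i \<and>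
       T i \<subseteq> B \<union> (\<Union>l<3. path_image (e l)) \<and> u \<noteq> pathstart (e i)) \<and>
      (\<forall>i<3. \<forall>i'<3. i \<noteq> i' \<longrightarrow> T i \<inter> T i' = {u})"
proof -
  have l3: "i < 3 \<longleftrightarrow> i = 0 \<or> i = 1 \<or> i = 2" for i :: nat by auto
  obtain u T0 T1 T2 where T:
    "compact T0" "path_connected T0" "u \<in> T0" "pathstart (e 0) \<in> T0"
    "compact T1" "path_connected T1" "u \<in> T1" "pathstart (e 1) \<in> T1"
    "compact T2" "path_connected T2" "u \<in> T2" "pathstart (e 2) \<in> T2"
    "T0 \<inter> T1 = {u}" "T0 \<inter> T2 = {u}" "T1 \<inter> T2 = {u}"
    "T0 \<union> T1 \<union> T2 \<subseteq> B \<union> path_image (e 0) \<union> path_image (e 1) \<union> path_image (e 2)"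
    "u \<notin> {pathstart (e 0), pathstart (e 1), pathstart (e 2)}"
    by (rule tripod[of B "e 0" "e 1" "e 2"]) (use assms in auto)
  let ?T = "\<lambda>i::nat. if i = 0 then T0 else if i = 1 then T1 else T2"
  have U: "(\<Union>j<3. path_image (e j)) = path_image (e 0) \<union> path_image (e 1) \<union> path_image (e 2)"
    by (auto simp: l3)
  have "?T i \<inter> ?T j = {u}" if "i < 3" "j < 3" "i \<noteq> j" for i j
    using that T(13-15) unfolding l3 by (auto simp: Int_commute)
  moreover have "?T i \<subseteq> B \<union> (\<Union>j<3. path_image (e j))" for i
    using T(16) unfolding U by auto
  moreover have "compact (?T i) \<and> path_connected (?T i) \<and> u \<in> ?T i" for i
    using T by simp
  moreover have "pathstart (e i) \<in> ?T i \<and> u \<noteq> pathstart (e i)" if "i < 3" for i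
    using that T unfolding l3 by auto
  ultimately show ?thesis by (intro exI[of _ u] exI[of _ ?T] conjI allI impI) blast+
qed

text \<open>Tripods in \<open>B 0\<close> and \<open>B 1\<close> have branching points
  \<open>u\<close> and \<open>v\<close>. Leg \<open>S i\<close>, region \<open>A i\<close> and leg
  \<open>T i\<close> together carry an arc \<open>c i\<close> from \<open>u\<close> to
  \<open>v\<close>, and these arcs form a theta curve. \<open>B 2\<close> with its connections to
  the regions \<open>A i\<close> then touches all three arcs from one face, against
  \<open>theta_no_common_face\<close>.\<close>

lemma no_planar_K33_regions:
  fixes A B :: "nat \<Rightarrow> complex set" and e :: "nat \<Rightarrow> nat \<Rightarrow> real \<Rightarrow> complex"
  assumes pc: "\<And>i. i < 3 \<Longrightarrow> path_connected (A i)" "\<And>j. j < 3 \<Longrightarrow> path_connected (B j)"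
    and disj: "\<And>i i'. i < 3 \<Longrightarrow> i' < 3 \<Longrightarrow> i \<noteq> i' \<Longrightarrow> A i \<inter> A i' = {}"
      "\<And>j j'. j < 3 \<Longrightarrow> j' < 3 \<Longrightarrow> j \<noteq> j' \<Longrightarrow> B j \<inter> B j' = {}"
      "\<And>i j. i < 3 \<Longrightarrow> j < 3 \<Longrightarrow> A i \<inter> B j = {}"
    and arcs: "\<And>i j. i < 3 \<Longrightarrow> j < 3 \<Longrightarrow> arc (e i j)"
      "\<And>i j. i < 3 \<Longrightarrow> j < 3 \<Longrightarrow> pathstart (e i j) \<in> A i"
      "\<And>i j. i < 3 \<Longrightarrow> j < 3 \<Longrightarrow> pathfinish (e i j) \<in> B j"
    and eA: "\<And>i j i'. i < 3 \<Longrightarrow> j < 3 \<Longrightarrow> i' < 3 \<Longrightarrow> path_image (e i j) \<inter> A i' \<subseteq> {pathstart (e i j)}"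
    and eB: "\<And>i j j'. i < 3 \<Longrightarrow> j < 3 \<Longrightarrow> j' < 3 \<Longrightarrow> path_image (e i j) \<inter> B j' \<subseteq> {pathfinish (e i j)}"
    and ee: "\<And>i j i' j'. i < 3 \<Longrightarrow> j < 3 \<Longrightarrow> i' < 3 \<Longrightarrow> j' < 3 \<Longrightarrow> (i, j) \<noteq> (i', j') \<Longrightarrow>
      path_image (e i j) \<inter> path_image (e i' j') \<subseteq> (A i \<inter> A i') \<union> (B j \<inter> B j')"
  shows False
proof -
  define Q where "Q j u T \<longleftrightarrow> (\<forall>i<3. compact (T i) \<and> path_connected (T i) \<and> u \<in> T i \<and> pathstart (e i j) \<in> T i \<and>
       T i \<subseteq> B j \<union> (\<Union>l<3. path_image (e l j)) \<and> u \<noteq> pathstart (e i j)) \<and>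
      (\<forall>i<3. \<forall>i'<3. i \<noteq> i' \<longrightarrow> T i \<inter> T i' = {u})" for j u T
  have tri: "\<exists>u T. Q j u T" if j: "j < 3" for j
  proof -
    have st: "pathstart (e i j) \<notin> B j" if "i < 3" for i using arcs(2) disj(3) that j by blast
    have it: "path_image (e i j) \<inter> path_image (e i' j) \<subseteq> B j" if "i < 3" "i' < 3" "i \<noteq> i'" for i i'
      using ee[of i j i' j] disj(1)[of i i'] that j by blast
    show ?thesis unfolding Q_def
      by (rule tripod_indexed[of "B j" "\<lambda>i. e i j"]) (use pc(2) arcs st it j in simp_all)
  qed
  obtain u S where "Q 0 u S" using tri[of 0] by auto
  then have S: "\<And>i. i < 3 \<Longrightarrow> compact (S i)" "\<And>i. i < 3 \<Longrightarrow> path_connected (S i)"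
    "\<And>i. i < 3 \<Longrightarrow> u \<in> S i" "\<And>i. i < 3 \<Longrightarrow> pathstart (e i 0) \<in> S i"
    "\<And>i. i < 3 \<Longrightarrow> S i \<subseteq> B 0 \<union> (\<Union>l<3. path_image (e l 0))" "\<And>i. i < 3 \<Longrightarrow> u \<noteq> pathstart (e i 0)"
    "\<And>i i'. i < 3 \<Longrightarrow> i' < 3 \<Longrightarrow> i \<noteq> i' \<Longrightarrow> S i \<inter> S i' = {u}"
    unfolding Q_def by blast+
  obtain v T where "Q 1 v T" using tri[of 1] by auto
  then have T: "\<And>i. i < 3 \<Longrightarrow> compact (T i)" "\<And>i. i < 3 \<Longrightarrow> path_connected (T i)"
    "\<And>i. i < 3 \<Longrightarrow> v \<in> T i" "\<And>i. i < 3 \<Longrightarrow> pathstart (e i 1) \<in> T i"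
    "\<And>i. i < 3 \<Longrightarrow> T i \<subseteq> B 1 \<union> (\<Union>l<3. path_image (e l 1))" "\<And>i. i < 3 \<Longrightarrow> v \<noteq> pathstart (e i 1)"
    "\<And>i i'. i < 3 \<Longrightarrow> i' < 3 \<Longrightarrow> i \<noteq> i' \<Longrightarrow> T i \<inter> T i' = {v}"
    unfolding Q_def by blast+
  have stA: "pathstart (e i j) \<in> A l \<Longrightarrow> l = i" if "i < 3" "j < 3" "l < 3" for i j l
    using arcs(2)[of i j] disj(1)[of i l] that by blast
  \<comment> \<open>A point of \<open>S i\<close> in some region \<open>A l\<close> lies on a
    connecting arc \<open>e m 0\<close>, and is therefore its start, the foot of leg
    \<open>m\<close>. Distinct legs share only \<open>u\<close>, which is not a foot; hence
    \<open>m = i\<close>.\<close>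
  have SA: "S i \<inter> A l \<subseteq> (if i = l then {pathstart (e i 0)} else {})" if il: "i < 3" "l < 3" for i l
  proof
    fix x assume x: "x \<in> S i \<inter> A l"
    then obtain m where m: "m < 3" "x \<in> path_image (e m 0)"
      using S(5)[of i] disj(3)[of l 0] il by auto
    then have xm: "x = pathstart (e m 0)" using eA[of m 0 l] x il by auto
    then have "m = l" using stA[of m 0 l] m x il by auto
    moreover have "i = m"
    proof (rule ccontr)
      assume "i \<noteq> m"
      then have "x = u" using S(7)[of i m] S(4)[of m] xm x m il by blast
      then show False using S(6)[of m] xm m by blast
    qed
    ultimately show "x \<in> (if i = l then {pathstart (e i 0)} else {})" using xm by auto
  qed
  have TA: "T i \<inter> A l \<subseteq> (if i = l then {pathstart (e i 1)} else {})" if il: "i < 3" "l < 3" for i l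
  proof
    fix x assume x: "x \<in> T i \<inter> A l"
    then obtain m where m: "m < 3" "x \<in> path_image (e m 1)"
      using T(5)[of i] disj(3)[of l 1] il by auto
    then have xm: "x = pathstart (e m 1)" using eA[of m 1 l] x il by auto
    then have "m = l" using stA[of m 1 l] m x il by auto
    moreover have "i = m"
    proof (rule ccontr)
      assume "i \<noteq> m"
      then have "x = v" using T(7)[of i m] T(4)[of m] xm x m il by blast
      then show False using T(6)[of m] xm m by blast
    qed
    ultimately show "x \<in> (if i = l then {pathstart (e i 1)} else {})" using xm by auto
  qed
  have uA: "u \<notin> A l" if "l < 3" for l
    using SA[of l l] S(3)[of l] S(6)[of l] that by auto
  \<comment> \<open>The tripods live on different regions \<open>B 0\<close>, \<open>B 1\<close> and
    on different connecting arcs. Such arcs can meet only in regions \<open>A m\<close>, where by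
    \<open>SA\<close> and \<open>TA\<close> each leg has nothing but its own foot.\<close>
  have STA: "S i \<inter> T l \<subseteq> A i \<inter> A l" if il: "i < 3" "l < 3" for i l
  proof
    fix x assume x: "x \<in> S i \<inter> T l"
    have "x \<notin> B 0 \<inter> B 1" using disj(2)[of 0 1] by auto
    moreover have "x \<in> B 0 \<Longrightarrow> x \<notin> path_image (e m 1)" if "m < 3" for m
      using eB[of m 1 0] arcs(3)[of m 1] disj(2)[of 0 1] that by auto
    moreover have "x \<in> B 1 \<Longrightarrow> x \<notin> path_image (e m 0)" if "m < 3" for m
      using eB[of m 0 1] arcs(3)[of m 0] disj(2)[of 0 1] that by auto
    ultimately obtain m m' where m: "m < 3" "m' < 3" "x \<in> path_image (e m 0)" "x \<in> path_image (e m' 1)"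
      using x S(5)[of i] T(5)[of l] il by blast
    then have xm: "x \<in> A m" "x \<in> A m'" using ee[of m 0 m' 1] disj(2)[of 0 1] by auto
    then have "i = m" "l = m'" using SA[of i m] TA[of l m'] x m il by (auto split: if_splits)
    then show "x \<in> A i \<inter> A l" using xm by blast
  qed
  have uv: "u \<noteq> v" using STA[of 0 0] S(3)[of 0] T(3)[of 0] uA[of 0] by auto
  define P where "P i = S i \<union> A i \<union> T i" for i
  have PP: "P i \<inter> P l \<subseteq> {u, v}" if il: "i < 3" "l < 3" "i \<noteq> l" for i l
  proof -
    have AA: "A i \<inter> A l = {}" using disj(1) il by blast
    have "S i \<inter> S l = {u}" "T i \<inter> T l = {v}" using S(7) T(7) il by blast+
    moreover have "S i \<inter> A l = {}" "A i \<inter> S l = {}" "T i \<inter> A l = {}" "A i \<inter> T l = {}"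
      using SA[of i l] SA[of l i] TA[of i l] TA[of l i] il by auto
    moreover have "S i \<inter> T l = {}" "T i \<inter> S l = {}"
      using STA[OF il(1,2)] STA[OF il(2,1)] AA by blast+
    ultimately show ?thesis using AA unfolding P_def Int_Un_distrib Int_Un_distrib2 by simp
  qed
  have "\<exists>c. arc c \<and> path_image c \<subseteq> P i \<and> pathstart c = u \<and> pathfinish c = v" if i: "i < 3" for i
  proof -
    have "path_connected (P i)" unfolding P_def
      using S(2)[of i] T(2)[of i] pc(1)[of i] S(4)[of i] T(4)[of i] arcs(2)[of i 0] arcs(2)[of i 1] i
      by (intro path_connected_Un) auto
    moreover have "u \<in> P i" "v \<in> P i" using S(3)[of i] T(3)[of i] i by (auto simp: P_def)
    ultimately show ?thesis using uv unfolding path_connected_arcwise by blast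
  qed
  then obtain c where c: "\<And>i. i < 3 \<Longrightarrow> arc (c i)" "\<And>i. i < 3 \<Longrightarrow> path_image (c i) \<subseteq> P i"
    "\<And>i. i < 3 \<Longrightarrow> pathstart (c i) = u" "\<And>i. i < 3 \<Longrightarrow> pathfinish (c i) = v"
    by metis
  have cu: "u \<in> path_image (c i)" "v \<in> path_image (c i)" if "i < 3" for i
    using c(3,4)[of i] that pathstart_in_path_image pathfinish_in_path_image by metis+
  have cint: "path_image (c i) \<inter> path_image (c l) = {u, v}" if "i < 3" "l < 3" "i \<noteq> l" for i l
    using PP[of i l] c(2)[of i] c(2)[of l] cu that by blast
  \<comment> \<open>The legs \<open>S i\<close> and \<open>T i\<close> are closed and meet at most
    inside \<open>A i\<close>, so an arc from \<open>u\<close> to \<open>v\<close> within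
    \<open>P i\<close> cannot bypass \<open>A i\<close>. This is where compactness of the legs is
    needed.\<close>
  have cA: "path_image (c i) \<inter> A i \<noteq> {}" if i: "i < 3" for i
    by (rule connected_Int_nonempty_if_closed_cover[of _ "S i" "T i"])
      (use c(1,2)[of i] cu[of i] S(1,3)[of i] T(1,3)[of i] STA[of i i] i in
        \<open>auto simp: P_def connected_arc_image compact_imp_closed\<close>)
  have disS: "X \<inter> S i = {}" if "i < 3" "X \<inter> B 0 = {}" "\<And>l. l < 3 \<Longrightarrow> X \<inter> path_image (e l 0) = {}" for X i
    using S(5)[OF that(1)] that(2,3) by blast
  have disT: "X \<inter> T i = {}" if "i < 3" "X \<inter> B 1 = {}" "\<And>l. l < 3 \<Longrightarrow> X \<inter> path_image (e l 1) = {}" for X i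
    using T(5)[OF that(1)] that(2,3) by blast
  have Be: "path_image (e l j) \<inter> B j' = {}" if "l < 3" "j < 3" "j' < 3" "j \<noteq> j'" for l j j'
    using eB[of l j j'] arcs(3)[of l j] disj(2)[of j j'] that by blast
  have BS: "B 2 \<inter> P i = {}" if i: "i < 3" for i
  proof -
    have Be2: "B 2 \<inter> path_image (e l j) = {}" if "l < 3" "j < 2" for l j
      using Be[of l j 2] that by (simp add: Int_commute)
    have "B 2 \<inter> S i = {}" by (rule disS) (use i disj(2)[of 2 0] Be2 in simp_all)
    moreover have "B 2 \<inter> T i = {}" by (rule disT) (use i disj(2)[of 2 1] Be2 in simp_all)
    moreover have "B 2 \<inter> A i = {}" using disj(3)[of i 2] i by (simp add: Int_commute)
    ultimately show ?thesis unfolding P_def Int_Un_distrib by simp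
  qed
  have Ze: "(A i \<union> path_image (e i 2)) \<inter> P l = {}" if il: "i < 3" "l < 3" "i \<noteq> l" for i l
  proof -
    let ?X = "path_image (e i 2) - A i"
    have XE: "?X \<inter> path_image (e m j) = {}" if "m < 3" "j < 2" for m j
    proof -
      have "path_image (e i 2) \<inter> path_image (e m j) \<subseteq> A i \<inter> A m \<union> B 2 \<inter> B j"
        by (rule ee) (use il that in auto)
      moreover have "B 2 \<inter> B j = {}" by (rule disj) (use that in auto)
      ultimately show ?thesis by blast
    qed
    have XB: "?X \<inter> B j = {}" if "j < 2" for j
      using Be[of i 2 j] il that by auto
    have AS: "A i \<inter> S l = {}" "A i \<inter> T l = {}" using SA[of l i] TA[of l i] il by auto
    have AA: "A i \<inter> A l = {}" using disj(1) il by blast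
    have "?X \<inter> S l = {}" by (rule disS) (use il XB XE in simp_all)
    moreover have "?X \<inter> T l = {}" by (rule disT) (use il XB XE in simp_all)
    moreover have "?X \<inter> A l = {}"
      using eA[of i 2 l] stA[of i 2 l] il by auto
    ultimately have "?X \<inter> P l = {}" "A i \<inter> P l = {}"
      using AS AA unfolding P_def Int_Un_distrib by simp_all
    then show ?thesis by blast
  qed
  \<comment> \<open>\<open>Z\<close> is a feeler: it leaves \<open>B 2\<close> along the connecting
    arc, may continue inside \<open>A i\<close>, and stops at its first contact \<open>a\<close>
    with the arc \<open>c i\<close>.\<close>
  have "\<exists>a Z. pathfinish (e i 2) \<in> Z \<and> Z \<subseteq> A i \<union> path_image (e i 2) \<and> Z \<inter> path_image (c i) = {a} \<and>
      connected Z \<and> connected (Z - {a})" if i: "i < 3" for i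
  proof -
    have "path_connected (A i \<union> path_image (reversepath (e i 2)))"
      using i by (intro path_connected_Un_arc pc) (auto simp: arc_reversepath arcs)
    then have "path_connected (A i \<union> path_image (e i 2))" by simp
    moreover have "pathfinish (e i 2) \<notin> path_image (c i)"
      using arcs(3)[of i 2] BS[of i] c(2)[of i] i by auto
    moreover have "closed (path_image (c i))" using c(1) i closed_arc_image by blast
    moreover have "(A i \<union> path_image (e i 2)) \<inter> path_image (c i) \<noteq> {}" using cA[OF i] by blast
    moreover have "pathfinish (e i 2) \<in> A i \<union> path_image (e i 2)"
      using pathfinish_in_path_image by blast
    ultimately obtain a Z where "path_connected Z" "pathfinish (e i 2) \<in> Z" "Z \<subseteq> A i \<union> path_image (e i 2)"
        "Z \<inter> path_image (c i) = {a}" "connected (Z - {a})"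
      using path_connected_first_hit[of "A i \<union> path_image (e i 2)" "path_image (c i)" "pathfinish (e i 2)"] by metis
    then show ?thesis by (blast dest: path_connected_imp_connected)
  qed
  then obtain a Z where Z: "\<And>i. i < 3 \<Longrightarrow> pathfinish (e i 2) \<in> Z i"
    "\<And>i. i < 3 \<Longrightarrow> Z i \<subseteq> A i \<union> path_image (e i 2)" "\<And>i. i < 3 \<Longrightarrow> Z i \<inter> path_image (c i) = {a i}"
    "\<And>i. i < 3 \<Longrightarrow> connected (Z i)" "\<And>i. i < 3 \<Longrightarrow> connected (Z i - {a i})"
    by metis
  \<comment> \<open>Removing the contact points keeps \<open>Y\<close> off the theta curve; putting
    one of them back keeps it connected, which is the form of contact that
    \<open>theta_no_common_face\<close> expects.\<close>
  define Y where "Y = B 2 \<union> (\<Union>i<3. Z i - {a i})"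
  have fin: "pathfinish (e i 2) \<in> B 2 \<inter> (Z i - {a i})" if i: "i < 3" for i
    using arcs(3)[of i 2] Z(1,3)[of i] BS[of i] c(2)[of i] i by auto
  have aZ: "a i \<in> Z i" "a i \<in> path_image (c i)" if "i < 3" for i using Z(3) that by blast+
  have Bc: "connected (B 2)" using pc(2) by (simp add: path_connected_imp_connected)
  have Yc: "connected Y"
  proof -
    have "Y = (\<Union>i<3. B 2 \<union> (Z i - {a i}))" unfolding Y_def by (auto simp: lessThan_nat_numeral)
    also have "connected \<dots>"
    proof (rule connected_Union)
      show "connected s" if "s \<in> (\<lambda>i. B 2 \<union> (Z i - {a i})) ` {..<3}" for s
        using that fin Z(5) Bc by (auto intro!: connected_Un)
      show "\<Inter> ((\<lambda>i. B 2 \<union> (Z i - {a i})) ` {..<3}) \<noteq> {}"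
        using fin[of 0] by auto
    qed
    finally show ?thesis .
  qed
  have Ya: "connected (insert (a i) Y)" if i: "i < 3" for i
  proof -
    have "insert (a i) Y = Y \<union> Z i" using aZ(1)[OF i] i unfolding Y_def by blast
    moreover have "Y \<inter> Z i \<noteq> {}" using fin[OF i] i unfolding Y_def by blast
    ultimately show ?thesis using connected_Un[OF Yc Z(4)[OF i]] by simp
  qed
  have Yc0: "Y \<inter> path_image (c i) = {}" if i: "i < 3" for i
  proof -
    have "(Z l - {a l}) \<inter> path_image (c i) = {}" if l: "l < 3" for l
    proof (cases "l = i")
      case True
      then show ?thesis using Z(3)[OF i] by blast
    next
      case False
      then show ?thesis using Ze[OF l i False] Z(2)[OF l] c(2)[OF i] by blast
    qed
    moreover have "B 2 \<inter> path_image (c i) = {}" using BS[OF i] c(2)[OF i] by blast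
    ultimately show ?thesis unfolding Y_def by blast
  qed
  \<comment> \<open>The contact point is not a pole: the poles belong to every \<open>P l\<close>,
    but the feeler of index \<open>i\<close> avoids \<open>P l\<close> for \<open>l\<close>
    different from \<open>i\<close>.\<close>
  have ac: "a i \<in> path_image (c i) - {u, v}" if i: "i < 3" for i
  proof -
    obtain l where l: "l < 3" "l \<noteq> i" by (metis zero_less_numeral one_less_numeral_iff semiring_norm(77) zero_neq_one)
    have "a i \<notin> P l" using Ze[OF i l(1)] l Z(2)[OF i] aZ(1)[OF i] by blast
    moreover have "u \<in> P l" "v \<in> P l" using S(3) T(3) l unfolding P_def by auto
    ultimately show ?thesis using aZ(2)[OF i] by blast
  qed
  have sp: "simple_path (c i)" if "i < 3" for i using c(1) that arc_imp_simple_path by blast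
  show False
  proof (rule theta_no_common_face[of "c 0" u v "c 1" "c 2" Y "a 0" "a 1" "a 2"])
    show "Y \<noteq> {}" using fin[of 0] unfolding Y_def by auto
    show "Y \<inter> (path_image (c 0) \<union> path_image (c 1) \<union> path_image (c 2)) = {}"
      using Yc0[of 0] Yc0[of 1] Yc0[of 2] by auto
  qed (use sp c(3,4) uv cint ac Ya in \<open>simp_all\<close>)
qed

section \<open>Minors and planarity\<close>

definition minor_model :: "'b set \<Rightarrow> 'b set set \<Rightarrow> 'a set \<Rightarrow> 'a set set \<Rightarrow> ('b \<Rightarrow> 'a set) \<Rightarrow> bool" where
  "minor_model VH EH V E \<phi> \<longleftrightarrow>
     (\<forall>x\<in>VH. \<phi> x \<subseteq> V \<and> connected_graph (\<phi> x) {e \<in> E. e \<subseteq> \<phi> x}) \<and>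
     (\<forall>x\<in>VH. \<forall>y\<in>VH. x \<noteq> y \<longrightarrow> \<phi> x \<inter> \<phi> y = {}) \<and>
     (\<forall>x\<in>VH. \<forall>y\<in>VH. x \<noteq> y \<longrightarrow> {x, y} \<in> EH \<longrightarrow> (\<exists>u\<in>\<phi> x. \<exists>v\<in>\<phi> y. {u, v} \<in> E))"

definition K33_minor :: "'a set \<Rightarrow> 'a set set \<Rightarrow> bool" where
  "K33_minor V E \<longleftrightarrow> (\<exists>\<phi>. minor_model {..<6::nat} {{i, j} | i j. i < 3 \<and> 3 \<le> j \<and> j < 6} V E \<phi>)"

lemma minor_modelD:
  assumes "minor_model VH EH V E \<phi>"
  shows "x \<in> VH \<Longrightarrow> \<phi> x \<subseteq> V" "x \<in> VH \<Longrightarrow> connected_graph (\<phi> x) {e \<in> E. e \<subseteq> \<phi> x}"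
    "x \<in> VH \<Longrightarrow> y \<in> VH \<Longrightarrow> x \<noteq> y \<Longrightarrow> \<phi> x \<inter> \<phi> y = {}"
    "x \<in> VH \<Longrightarrow> y \<in> VH \<Longrightarrow> x \<noteq> y \<Longrightarrow> {x, y} \<in> EH \<Longrightarrow> \<exists>u\<in>\<phi> x. \<exists>v\<in>\<phi> y. {u, v} \<in> E"
  using assms by (simp_all add: minor_model_def)

text \<open>The part of the drawing occupied by the subgraph induced on \<open>S\<close>; applied to
  branch sets, it supplies the regions of \<open>no_planar_K33_regions\<close>.\<close>

definition region :: "('a \<Rightarrow> complex) \<Rightarrow> ('a set \<Rightarrow> real \<Rightarrow> complex) \<Rightarrow> 'a set set \<Rightarrow> 'a set \<Rightarrow> complex set" where
  "region f g E S = f ` S \<union> (\<Union>e\<in>{e \<in> E. e \<subseteq> S}. path_image (g e))"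

lemma path_connected_region:
  assumes con: "connected_graph S {e \<in> E. e \<subseteq> S}"
    and gE: "\<And>e. e \<in> E \<Longrightarrow> arc (g e) \<and> {pathstart (g e), pathfinish (g e)} = f ` e"
    and card: "\<And>e. e \<in> E \<Longrightarrow> card e = 2"
  shows "path_connected (region f g E S)"
proof -
  let ?R = "region f g E S"
  have fe: "f ` e \<subseteq> path_image (g e)" if "e \<in> E" for e
    using gE[OF that] pathstart_in_path_image[of "g e"] pathfinish_in_path_image[of "g e"]
    by (metis empty_subsetI insert_subset)
  have edge: "path_component ?R (f x) p" if "e \<in> E" "e \<subseteq> S" "x \<in> e" "p \<in> path_image (g e)" for e x p
  proof -
    have "path_connected (path_image (g e))"
      using gE that by (intro path_connected_path_image arc_imp_path) auto
    moreover have "f x \<in> path_image (g e)"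
      using fe[OF that(1)] that(3) by blast
    ultimately have "path_component (path_image (g e)) (f x) p"
      using that(4) by (simp add: path_connected_component)
    then show ?thesis
      by (rule path_component_of_subset[rotated]) (use that in \<open>auto simp: region_def\<close>)
  qed
  have reach: "path_component ?R (f u) (f v)"
    if "(u, v) \<in> {(x, y). {x, y} \<in> {e \<in> E. e \<subseteq> S}}\<^sup>*" "u \<in> S" for u v
    using that(1)
  proof (induction rule: rtrancl_induct)
    case base
    then show ?case using that(2) by (simp add: path_component_refl region_def)
  next
    case (step y z)
    then have e: "{y, z} \<in> E" "{y, z} \<subseteq> S" by auto
    have "f z \<in> path_image (g {y, z})"
      using fe[OF e(1)] by blast
    then have "path_component ?R (f y) (f z)" using edge[OF e] by auto
    then show ?case using step.IH path_component_trans by blast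
  qed
  have base: "\<exists>u\<in>S. path_component ?R (f u) p" if p: "p \<in> ?R" for p
  proof (cases "p \<in> f ` S")
    case True
    then show ?thesis using p path_component_refl by blast
  next
    case False
    then obtain e where e: "e \<in> E" "e \<subseteq> S" "p \<in> path_image (g e)" using p unfolding region_def by blast
    have "e \<noteq> {}" using card[OF e(1)] by auto
    then show ?thesis using edge[OF e(1,2) _ e(3)] e(2) by blast
  qed
  show ?thesis unfolding path_connected_component
  proof (intro ballI)
    fix p q assume "p \<in> ?R" "q \<in> ?R"
    then obtain u v where uv: "u \<in> S" "v \<in> S" "path_component ?R (f u) p" "path_component ?R (f v) q"
      using base by meson
    then have "path_component ?R (f u) (f v)" using con reach unfolding connected_graph_def by blast
    then show "path_component ?R p q" using uv path_component_sym path_component_trans by meson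
  qed
qed

text \<open>The drawings of disjoint branch sets are disjoint path-connected regions. For each of
  the nine edges of K_{3,3} one edge of the graph between the two branch sets is chosen, and its
  drawing serves as the connecting arc.\<close>

theorem planar_graph_no_K33_minor:
  assumes "planar_graph V E" "simple_graph V E"
  shows "\<not> K33_minor V E"
proof
  assume "K33_minor V E"
  then obtain \<phi> :: "nat \<Rightarrow> 'a set" where
    \<phi>: "minor_model {..<6} {{i, j} | i j. i < 3 \<and> 3 \<le> j \<and> j < 6} V E \<phi>"
    unfolding K33_minor_def by blast
  note D = minor_modelD[OF \<phi>]
  have sE: "e \<subseteq> V" "card e = 2" if "e \<in> E" for e using assms(2) that by (auto simp: simple_graph_def)
  obtain f :: "'a \<Rightarrow> complex" and g where fg: "inj_on f V \<and>
      (\<forall>e\<in>E. arc (g e) \<and> {pathstart (g e), pathfinish (g e)} = f ` e \<and> path_image (g e) \<inter> f ` V = f ` e) \<and>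
      (\<forall>e\<in>E. \<forall>e'\<in>E. e \<noteq> e' \<longrightarrow> path_image (g e) \<inter> path_image (g e') = f ` (e \<inter> e'))"
    using assms(1) unfolding planar_graph_def by (elim exE)
  have inj: "inj_on f V" using fg by simp
  have gE: "arc (g e) \<and> {pathstart (g e), pathfinish (g e)} = f ` e"
    and gV: "path_image (g e) \<inter> f ` V = f ` e" if "e \<in> E" for e
    using fg that by simp_all
  have gg: "path_image (g e) \<inter> path_image (g e') = f ` (e \<inter> e')" if "e \<in> E" "e' \<in> E" "e \<noteq> e'" for e e'
    using fg that by simp
  let ?R = "region f g E"
  \<comment> \<open>An edge that is not drawn as part of the region of \<open>S\<close> meets it
    only at those of its own endpoints that lie in \<open>S\<close>. All disjointness claims below
    go back to this.\<close>
  have eR: "path_image (g e) \<inter> ?R S \<subseteq> f ` (e \<inter> S)" if "e \<in> E" "\<not> e \<subseteq> S" "S \<subseteq> V" for e S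
  proof
    fix p assume p: "p \<in> path_image (g e) \<inter> ?R S"
    show "p \<in> f ` (e \<inter> S)"
    proof (cases "p \<in> f ` S")
      case True
      then have "p \<in> f ` e" using gV[OF that(1)] p that(3) by blast
      then show ?thesis
        using True inj_on_image_Int[OF inj sE(1)[OF that(1)] that(3)] by blast
    next
      case False
      then obtain e' where e': "e' \<in> E" "e' \<subseteq> S" "p \<in> path_image (g e')" using p unfolding region_def by blast
      then have "e \<noteq> e'" using that by blast
      then show ?thesis using gg[OF that(1) e'(1)] p e' by blast
    qed
  qed
  have RR: "?R S \<inter> ?R S' = {}" if "S \<subseteq> V" "S' \<subseteq> V" "S \<inter> S' = {}" for S S'
  proof -
    have "?R S \<inter> path_image (g e) = {}" if e: "e \<in> E" "e \<subseteq> S'" for e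
    proof -
      have "e \<noteq> {}" using sE(2)[OF e(1)] by auto
      then have "\<not> e \<subseteq> S" using e \<open>S \<inter> S' = {}\<close> by blast
      moreover have "e \<inter> S = {}" using e \<open>S \<inter> S' = {}\<close> by blast
      ultimately show ?thesis using eR[OF e(1) _ \<open>S \<subseteq> V\<close>] by auto
    qed
    moreover have "?R S \<inter> f ` S' = {}"
    proof -
      have "path_image (g e) \<inter> f ` S' = {}" if e: "e \<in> E" "e \<subseteq> S" for e
      proof -
        have "path_image (g e) \<inter> f ` S' \<subseteq> f ` e \<inter> f ` S'" using gV[OF e(1)] \<open>S' \<subseteq> V\<close> by blast
        also have "\<dots> = f ` (e \<inter> S')" by (rule inj_on_image_Int[symmetric, OF inj sE(1)[OF e(1)] \<open>S' \<subseteq> V\<close>])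
        finally show ?thesis using e \<open>S \<inter> S' = {}\<close> by auto
      qed
      moreover have "f ` S \<inter> f ` S' = {}"
        using inj_on_image_Int[OF inj \<open>S \<subseteq> V\<close> \<open>S' \<subseteq> V\<close>] \<open>S \<inter> S' = {}\<close> by auto
      ultimately show ?thesis unfolding region_def by blast
    qed
    ultimately show ?thesis unfolding region_def[of f g E S'] by blast
  qed
  have "\<exists>x y. x \<in> \<phi> i \<and> y \<in> \<phi> (j + 3) \<and> {x, y} \<in> E" if "i < 3" "j < 3" for i j
    using D(4)[of i "j + 3"] that by fastforce
  then obtain x y where xy: "\<And>i j. i < 3 \<Longrightarrow> j < 3 \<Longrightarrow> x i j \<in> \<phi> i"
    "\<And>i j. i < 3 \<Longrightarrow> j < 3 \<Longrightarrow> y i j \<in> \<phi> (j + 3)" "\<And>i j. i < 3 \<Longrightarrow> j < 3 \<Longrightarrow> {x i j, y i j} \<in> E"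
    by metis
  define d where "d i j = {x i j, y i j}" for i j
  \<comment> \<open>Planarity fixes the endpoints of an arc only as an unordered pair, so the arc is
    reversed if necessary to run from \<open>x i j\<close> to \<open>y i j\<close>.\<close>
  define e where "e i j = (if pathstart (g (d i j)) = f (x i j) then g (d i j) else reversepath (g (d i j)))" for i j
  have dE: "d i j \<in> E" if "i < 3" "j < 3" for i j using xy that by (simp add: d_def)
  have pe: "path_image (e i j) = path_image (g (d i j))" for i j by (simp add: e_def)
  have ends: "pathstart (e i j) = f (x i j)" "pathfinish (e i j) = f (y i j)" if "i < 3" "j < 3" for i j
    using gE[OF dE[OF that]] unfolding e_def by (auto simp: d_def doubleton_eq_iff)
  have \<phi>V: "\<phi> i \<subseteq> V" if "i < 6" for i using D(1) that by simp
  have \<phi>d: "\<phi> i \<inter> \<phi> j = {}" if "i < 6" "j < 6" "i \<noteq> j" for i j using D(3) that by simp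
  have xin: "x i j \<in> \<phi> l \<longleftrightarrow> l = i" if "i < 3" "j < 3" "l < 6" for i j l
    using xy(1)[of i j] \<phi>d[of i l] that by auto
  have yin: "y i j \<in> \<phi> l \<longleftrightarrow> l = j + 3" if "i < 3" "j < 3" "l < 6" for i j l
    using xy(2)[of i j] \<phi>d[of "j + 3" l] that by auto
  have dR: "path_image (e i j) \<inter> ?R (\<phi> l) \<subseteq> f ` (d i j \<inter> \<phi> l)" if "i < 3" "j < 3" "l < 6" for i j l
  proof -
    have "\<not> d i j \<subseteq> \<phi> l" using xin[OF that] yin[OF that] that by (auto simp: d_def)
    then show ?thesis unfolding pe using eR[OF dE] \<phi>V that by simp
  qed
  have sub: "f ` S \<subseteq> ?R S" for S by (auto simp: region_def)
  show False
  proof (rule no_planar_K33_regions[of "\<lambda>i. ?R (\<phi> i)" "\<lambda>j. ?R (\<phi> (j + 3))" e])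
    show "path_connected (?R (\<phi> i))" if "i < 3" for i
      by (rule path_connected_region) (use D(2)[of i] gE sE that in auto)
    show "path_connected (?R (\<phi> (i + 3)))" if "i < 3" for i
      by (rule path_connected_region) (use D(2)[of "i + 3"] gE sE that in auto)
    show "?R (\<phi> i) \<inter> ?R (\<phi> i') = {}" if "i < 3" "i' < 3" "i \<noteq> i'" for i i'
      by (rule RR) (use \<phi>V \<phi>d that in auto)
    show "?R (\<phi> (i + 3)) \<inter> ?R (\<phi> (i' + 3)) = {}" if "i < 3" "i' < 3" "i \<noteq> i'" for i i'
      by (rule RR) (use \<phi>V \<phi>d that in auto)
    show "?R (\<phi> i) \<inter> ?R (\<phi> (j + 3)) = {}" if "i < 3" "j < 3" for i j
      by (rule RR) (use \<phi>V \<phi>d that in auto)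
    fix i j :: nat assume ij: "i < 3" "j < 3"
    show "arc (e i j)" using gE[OF dE[OF ij]] by (auto simp: e_def arc_reversepath)
    show "pathstart (e i j) \<in> ?R (\<phi> i)" "pathfinish (e i j) \<in> ?R (\<phi> (j + 3))"
      using sub xy(1,2)[OF ij] ends[OF ij] by auto
    show "path_image (e i j) \<inter> ?R (\<phi> i') \<subseteq> {pathstart (e i j)}" if "i' < 3" for i'
      using dR[of i j i'] yin[of i j i'] ij that ends[OF ij] by (auto simp: d_def)
    show "path_image (e i j) \<inter> ?R (\<phi> (j' + 3)) \<subseteq> {pathfinish (e i j)}" if "j' < 3" for j'
      using dR[of i j "j' + 3"] xin[of i j "j' + 3"] ij that ends[OF ij] by (auto simp: d_def)
    fix i' j' :: nat assume ij': "i' < 3" "j' < 3" "(i, j) \<noteq> (i', j')"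
    have "x i j \<notin> d i' j' \<or> y i j \<notin> d i' j'"
    proof (rule ccontr)
      assume "\<not> ?thesis"
      moreover have "x i j \<noteq> y i' j'" "y i j \<noteq> x i' j'"
        using xin[of i j "j' + 3"] yin[of i' j' "j' + 3"] xin[of i' j' "j + 3"] yin[of i j "j + 3"] ij ij' by auto
      ultimately have "x i j = x i' j'" "y i j = y i' j'" by (auto simp: d_def)
      then show False
        using xin[of i j i'] xin[of i' j' i'] yin[of i j "j' + 3"] yin[of i' j' "j' + 3"] ij ij' by auto
    qed
    then have "d i j \<noteq> d i' j'" by (auto simp: d_def)
    then have "path_image (e i j) \<inter> path_image (e i' j') \<subseteq> f ` (d i j \<inter> d i' j')"
      unfolding pe using gg[OF dE[OF ij] dE[OF ij'(1,2)]] by blast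
    moreover have "d i j \<inter> d i' j' \<subseteq> \<phi> i \<inter> \<phi> i' \<union> \<phi> (j + 3) \<inter> \<phi> (j' + 3)"
    proof
      fix z assume z: "z \<in> d i j \<inter> d i' j'"
      have "x i j \<noteq> y i' j'" "y i j \<noteq> x i' j'"
        using xin[of i j "j' + 3"] yin[of i' j' "j' + 3"] xin[of i' j' "j + 3"] yin[of i j "j + 3"] ij ij' by auto
      then have "z = x i j \<and> z = x i' j' \<or> z = y i j \<and> z = y i' j'" using z by (auto simp: d_def)
      then show "z \<in> \<phi> i \<inter> \<phi> i' \<union> \<phi> (j + 3) \<inter> \<phi> (j' + 3)" using xy(1,2) ij ij' by auto
    qed
    ultimately show "path_image (e i j) \<inter> path_image (e i' j') \<subseteq>
        ?R (\<phi> i) \<inter> ?R (\<phi> i') \<union> ?R (\<phi> (j + 3)) \<inter> ?R (\<phi> (j' + 3))"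
      using sub by blast
  qed
qed

section \<open>Minors of token graphs\<close>

lemma connected_graphD:
  assumes "connected_graph S F"
  shows "S \<noteq> {}" "u \<in> S \<Longrightarrow> v \<in> S \<Longrightarrow> (u, v) \<in> {(x, y). {x, y} \<in> F}\<^sup>*"
  using assms by (simp_all add: connected_graph_def)

text \<open>A walk through the indices in \<open>S\<close> lifts to the union: move freely within
  each \<open>\<phi> x\<close> and change over along a connecting edge. This gives transitivity of
  minors as well as connectedness of paths.\<close>

lemma connected_graph_UN:
  assumes S: "connected_graph S {e \<in> F. e \<subseteq> S}"
    and con: "\<And>x. x \<in> S \<Longrightarrow> connected_graph (\<phi> x) {e \<in> E. e \<subseteq> \<phi> x}"
    and edge: "\<And>x y. x \<in> S \<Longrightarrow> y \<in> S \<Longrightarrow> x \<noteq> y \<Longrightarrow> {x, y} \<in> F \<Longrightarrow> \<exists>u\<in>\<phi> x. \<exists>v\<in>\<phi> y. {u, v} \<in> E"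
  shows "connected_graph (\<Union>x\<in>S. \<phi> x) {e \<in> E. e \<subseteq> (\<Union>x\<in>S. \<phi> x)}"
proof -
  let ?U = "\<Union>x\<in>S. \<phi> x"
  let ?R = "{(x, y). {x, y} \<in> {e \<in> E. e \<subseteq> ?U}}"
  have inside: "(u, v) \<in> ?R\<^sup>*" if "x \<in> S" "u \<in> \<phi> x" "v \<in> \<phi> x" for x u v
  proof -
    have "(u, v) \<in> {(a, b). {a, b} \<in> {e \<in> E. e \<subseteq> \<phi> x}}\<^sup>*"
      by (rule connected_graphD(2)[OF con[OF that(1)] that(2,3)])
    moreover have "{(a, b). {a, b} \<in> {e \<in> E. e \<subseteq> \<phi> x}} \<subseteq> ?R" using that(1) by blast
    ultimately show ?thesis using rtrancl_mono by blast
  qed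
  have across: "\<forall>v\<in>\<phi> y. (u, v) \<in> ?R\<^sup>*"
    if "(x, y) \<in> {(x, y). {x, y} \<in> {e \<in> F. e \<subseteq> S}}\<^sup>*" "x \<in> S" "u \<in> \<phi> x" for x y u
    using that(1)
  proof (induction rule: rtrancl_induct)
    case base
    then show ?case using inside that by blast
  next
    case (step y z)
    then have yz: "{y, z} \<in> F" "y \<in> S" "z \<in> S" by auto
    show ?case
    proof (cases "y = z")
      case False
      then obtain a b where ab: "a \<in> \<phi> y" "b \<in> \<phi> z" "{a, b} \<in> E" using edge yz by blast
      then have "(a, b) \<in> ?R" using yz by auto
      then have "(u, b) \<in> ?R\<^sup>*" using step.IH ab(1) by (meson rtrancl.rtrancl_into_rtrancl)
      then show ?thesis using inside[OF yz(3) ab(2)] by (meson rtrancl_trans)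
    qed (use step.IH in simp)
  qed
  have "?U \<noteq> {}" using connected_graphD(1)[OF S] connected_graphD(1)[OF con] by auto
  moreover have "(u, v) \<in> ?R\<^sup>*" if u: "u \<in> ?U" and v: "v \<in> ?U" for u v
  proof -
    obtain x y where xy: "x \<in> S" "u \<in> \<phi> x" "y \<in> S" "v \<in> \<phi> y" using u v by blast
    show ?thesis using across[OF connected_graphD(2)[OF S xy(1,3)] xy(1,2)] xy(4) by blast
  qed
  ultimately show ?thesis unfolding connected_graph_def by simp
qed

lemma minor_model_trans:
  assumes G: "minor_model VH EH V E \<phi>" and H: "minor_model VK EK VH EH \<psi>"
  shows "minor_model VK EK V E (\<lambda>k. \<Union>x\<in>\<psi> k. \<phi> x)"
proof -
  note g = minor_modelD[OF G] and h = minor_modelD[OF H]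
  show ?thesis unfolding minor_model_def
  proof (intro conjI ballI impI)
    fix k assume k: "k \<in> VK"
    show "(\<Union>x\<in>\<psi> k. \<phi> x) \<subseteq> V" using h(1)[OF k] g(1) by blast
    show "connected_graph (\<Union>x\<in>\<psi> k. \<phi> x) {e \<in> E. e \<subseteq> (\<Union>x\<in>\<psi> k. \<phi> x)}"
      by (rule connected_graph_UN[OF h(2)[OF k]]) (use h(1)[OF k] g(2,4) in blast)+
    fix l assume l: "l \<in> VK" "k \<noteq> l"
    have kl: "\<psi> k \<inter> \<psi> l = {}" by (rule h(3)[OF k l])
    have "\<phi> x \<inter> \<phi> y = {}" if "x \<in> \<psi> k" "y \<in> \<psi> l" for x y
      by (rule g(3)) (use h(1)[OF k] h(1)[OF l(1)] kl that in blast)+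
    then show "(\<Union>x\<in>\<psi> k. \<phi> x) \<inter> (\<Union>x\<in>\<psi> l. \<phi> x) = {}" by blast
    assume "{k, l} \<in> EK"
    then obtain x y where xy: "x \<in> \<psi> k" "y \<in> \<psi> l" "{x, y} \<in> EH" using h(4)[OF k l] by blast
    then have "x \<in> VH" "y \<in> VH" "x \<noteq> y" using h(1)[OF k] h(1)[OF l(1)] kl by blast+
    then obtain u v where "u \<in> \<phi> x" "v \<in> \<phi> y" "{u, v} \<in> E" using g(4) xy(3) by blast
    then show "\<exists>u\<in>\<Union>x\<in>\<psi> k. \<phi> x. \<exists>v\<in>\<Union>x\<in>\<psi> l. \<phi> x. {u, v} \<in> E" using xy by blast
  qed
qed

corollary K33_minor_trans:
  assumes "minor_model VH EH V E \<phi>" "K33_minor VH EH"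
  shows "K33_minor V E"
  using assms minor_model_trans unfolding K33_minor_def by blast

lemma token_edgesI:
  assumes "u \<notin> C" "v \<notin> C" "u \<noteq> v" "{u, v} \<in> E" "insert u C \<subseteq> V" "insert v C \<subseteq> V"
    "finite C" "Suc (card C) = k"
  shows "{insert u C, insert v C} \<in> token_edges V E k"
proof -
  have "insert u C - insert v C \<union> (insert v C - insert u C) = {u, v}" using assms by auto
  moreover have "insert u C \<in> token_vertices V k" "insert v C \<in> token_vertices V k"
    using assms by (auto simp: token_vertices_def)
  ultimately show ?thesis using assms(4) unfolding token_edges_def by blast
qed

text \<open>The definition only fixes the symmetric difference. As both sets have the same size and
  differ, each of \<open>A - B\<close> and \<open>B - A\<close> is a single vertex, so adjacency
  means that one token slides along an edge while the tokens on \<open>C\<close> stay.\<close>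

lemma token_edgesE:
  assumes "{A, B} \<in> token_edges V E k" "A \<noteq> B" "finite V"
  obtains a b C where "A = insert a C" "B = insert b C" "a \<notin> C" "b \<notin> C" "a \<noteq> b" "{a, b} \<in> E"
proof -
  obtain A' B' a b where *: "{A, B} = {A', B'}" "A' \<in> token_vertices V k" "B' \<in> token_vertices V k"
      "(A' - B') \<union> (B' - A') = {a, b}" "{a, b} \<in> E"
    using assms(1) unfolding token_edges_def mem_Collect_eq by (elim exE conjE) (rule that)
  then have "A = A' \<and> B = B' \<or> A = B' \<and> B = A'" by (simp add: doubleton_eq_iff)
  then have AB: "A \<subseteq> V" "B \<subseteq> V" "card A = card B" and ab: "(A - B) \<union> (B - A) = {a, b}" "{a, b} \<in> E"
    using * by (auto simp: token_vertices_def)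
  have fin: "finite A" "finite B" using AB assms(3) finite_subset by blast+
  have "card (A - B) = card (B - A)"
    using AB(3) card_Diff_subset_Int[of A B] card_Diff_subset_Int[of B A] fin by (simp add: Int_commute)
  moreover have "A - B \<noteq> {}"
    using calculation assms(2) fin by (metis Diff_eq_empty_iff card_0_eq card.empty finite_Diff subset_antisym)
  moreover have "B - A \<noteq> {}"
    using calculation fin by (metis card_0_eq card.empty finite_Diff)
  ultimately obtain x y where xy: "x \<in> A - B" "y \<in> B - A" by blast
  then have "x \<in> {a, b}" "y \<in> {a, b}" "x \<noteq> y" unfolding ab(1)[symmetric] by auto
  then have xy': "{x, y} = {a, b}" "x \<noteq> y" by auto
  have "A - B \<subseteq> {x, y}" "B - A \<subseteq> {x, y}" unfolding xy'(1) ab(1)[symmetric] by simp_all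
  then have "A - B = {x}" "B - A = {y}" using xy by auto
  then have "A = insert x (A \<inter> B)" "B = insert y (A \<inter> B)" by auto
  moreover have "{x, y} \<in> E" using xy' ab(2) by simp
  ultimately show ?thesis using that[of x "A \<inter> B" y] xy xy'(2) by simp
qed

text \<open>Exactly one token in each branch set indexed by A, all remaining tokens parked on W.\<close>

definition token_branch :: "('b \<Rightarrow> 'a set) \<Rightarrow> 'a set \<Rightarrow> 'b set \<Rightarrow> 'a set set" where
  "token_branch \<phi> W A = {W \<union> t ` A | t. \<forall>x\<in>A. t x \<in> \<phi> x}"

context
  fixes VH :: "'b set" and EH :: "'b set set" and V :: "'a set" and E :: "'a set set" and \<phi> :: "'b \<Rightarrow> 'a set"
    and W :: "'a set" and l :: nat
  assumes G: "minor_model VH EH V E \<phi>" and fH: "finite VH" and fW: "finite W" and WV: "W \<subseteq> V"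
    and W\<phi>: "\<And>x. x \<in> VH \<Longrightarrow> W \<inter> \<phi> x = {}"
begin

private lemmas g = minor_modelD[OF G]

text \<open>A choice \<open>t\<close> of one vertex per branch set is injective because branch sets
  are disjoint, hence the exact token count. The last claim is what tells configurations over
  different index sets apart.\<close>

private lemma system:
  assumes A: "A \<subseteq> VH" and t: "\<forall>x\<in>A. t x \<in> \<phi> x"
  shows "W \<union> t ` A \<subseteq> V" "card (W \<union> t ` A) = card A + card W" "finite (W \<union> t ` A)"
    "x \<in> VH \<Longrightarrow> x \<notin> A \<Longrightarrow> (W \<union> t ` A) \<inter> \<phi> x = {}"
proof -
  have fA: "finite A" using A fH finite_subset by blast
  have inj: "inj_on t A"
  proof (rule inj_onI)
    fix x y assume xy: "x \<in> A" "y \<in> A" "t x = t y"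
    then have "t x \<in> \<phi> x \<inter> \<phi> y" using t by auto
    then show "x = y" using g(3)[of x y] xy A by blast
  qed
  have disj: "W \<inter> t ` A = {}" using W\<phi> A t by blast
  show "W \<union> t ` A \<subseteq> V" using WV A t g(1) by blast
  show "finite (W \<union> t ` A)" using fA fW by simp
  show "card (W \<union> t ` A) = card A + card W"
    using card_Un_disjoint[OF fW _ disj] fA card_image[OF inj] by simp
  show "(W \<union> t ` A) \<inter> \<phi> x = {}" if x: "x \<in> VH" "x \<notin> A"
  proof -
    have "t y \<notin> \<phi> x" if "y \<in> A" for y
    proof -
      have "\<phi> y \<inter> \<phi> x = {}" by (rule g(3)) (use A that x in auto)
      then show ?thesis using t that by blast
    qed
    then show ?thesis using W\<phi>[OF x(1)] by blast
  qed
qed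

private lemma token_edge:
  assumes C: "C \<subseteq> VH" "\<forall>x\<in>C. t x \<in> \<phi> x" and xy: "x \<in> VH - C" "y \<in> VH - C"
    and uv: "u \<in> \<phi> x" "v \<in> \<phi> y" "{u, v} \<in> E" "u \<noteq> v"
  shows "{insert u (W \<union> t ` C), insert v (W \<union> t ` C)} \<in> token_edges V E (Suc (card C) + card W)"
proof -
  have "u \<in> V" "v \<in> V" using g(1) xy uv by blast+
  then show ?thesis by (intro token_edgesI) (use system[OF C] xy uv in auto)
qed

text \<open>Tokens are moved one at a time, each along a walk within its own branch set, which no
  other token enters: \<open>one\<close> moves a single token, \<open>all\<close> moves those
  indexed by \<open>D\<close>, by induction on \<open>D\<close>.\<close>

private lemma token_branch_connected:
  assumes A: "A \<subseteq> VH" "card A = l"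
  shows "connected_graph (token_branch \<phi> W A)
    {e \<in> token_edges V E (l + card W). e \<subseteq> token_branch \<phi> W A}"
proof -
  let ?B = "token_branch \<phi> W A"
  let ?R = "{(x, y). {x, y} \<in> {e \<in> token_edges V E (l + card W). e \<subseteq> ?B}}"
  have fA: "finite A" using A fH finite_subset by blast
  have one: "(W \<union> t(x := u) ` A, W \<union> t(x := v) ` A) \<in> ?R\<^sup>*"
    if t: "\<forall>x\<in>A. t x \<in> \<phi> x" and x: "x \<in> A" and u: "u \<in> \<phi> x" and v: "v \<in> \<phi> x" for t x u v
  proof -
    let ?C = "A - {x}"
    have upd: "W \<union> t(x := w) ` A = insert w (W \<union> t ` ?C)" for w using x by (auto simp: image_iff)
    have mem: "insert w (W \<union> t ` ?C) \<in> ?B" if "w \<in> \<phi> x" for w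
    proof -
      have "\<forall>y\<in>A. (t(x := w)) y \<in> \<phi> y" using t that by simp
      then show ?thesis unfolding upd[symmetric] token_branch_def by blast
    qed
    have "(u, v) \<in> {(a, b). {a, b} \<in> {e \<in> E. e \<subseteq> \<phi> x}}\<^sup>*"
      by (rule connected_graphD(2)[OF g(2) u v]) (use A x in blast)
    then have "(insert u (W \<union> t ` ?C), insert v (W \<union> t ` ?C)) \<in> ?R\<^sup>*"
    proof (induction rule: rtrancl_induct)
      case (step a b)
      have ab: "a \<in> \<phi> x" "b \<in> \<phi> x" "{a, b} \<in> E" using step.hyps(2) by auto
      show ?case
      proof (cases "a = b")
        case False
        have "{insert a (W \<union> t ` ?C), insert b (W \<union> t ` ?C)} \<in> token_edges V E (Suc (card ?C) + card W)"
          by (rule token_edge[of _ _ x x]) (use A x t ab False in auto)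
        moreover have "Suc (card ?C) = l" using A x fA by (metis card_Suc_Diff1)
        ultimately have "(insert a (W \<union> t ` ?C), insert b (W \<union> t ` ?C)) \<in> ?R"
          using mem[OF ab(1)] mem[OF ab(2)] by simp
        then show ?thesis using step.IH by (meson rtrancl.rtrancl_into_rtrancl)
      qed (use step.IH in simp)
    qed simp
    then show ?thesis unfolding upd .
  qed
  have all: "(W \<union> t ` A, W \<union> (\<lambda>x. if x \<in> D then t' x else t x) ` A) \<in> ?R\<^sup>*"
    if t: "\<forall>x\<in>A. t x \<in> \<phi> x" "\<forall>x\<in>A. t' x \<in> \<phi> x" and D: "D \<subseteq> A" for t t' D
  proof -
    have "finite D" using D fA finite_subset by blast
    then show ?thesis using D
    proof (induction D rule: finite_induct)
      case (insert x D)
      let ?s = "\<lambda>y. if y \<in> D then t' y else t y"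
      have "(W \<union> ?s(x := t x) ` A, W \<union> ?s(x := t' x) ` A) \<in> ?R\<^sup>*"
        by (rule one) (use insert.prems t in auto)
      moreover have "?s(x := t x) = ?s" using insert.hyps by auto
      moreover have "?s(x := t' x) = (\<lambda>y. if y \<in> insert x D then t' y else t y)" by auto
      ultimately show ?case using insert.IH insert.prems by (metis (no_types, lifting) insert_subset rtrancl_trans)
    qed simp
  qed
  have "(X, Y) \<in> ?R\<^sup>*" if XY: "X \<in> ?B" "Y \<in> ?B" for X Y
  proof -
    obtain t t' where t: "X = W \<union> t ` A" "\<forall>x\<in>A. t x \<in> \<phi> x" "Y = W \<union> t' ` A" "\<forall>x\<in>A. t' x \<in> \<phi> x"
      using XY unfolding token_branch_def mem_Collect_eq by (elim exE conjE) (rule that)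
    have "(\<lambda>x. if x \<in> A then t' x else t x) ` A = t' ` A" by (rule image_cong) auto
    then show ?thesis using all[OF t(2,4) order_refl] t by simp
  qed
  moreover have "?B \<noteq> {}"
  proof -
    have "\<forall>x\<in>A. \<exists>u. u \<in> \<phi> x" using connected_graphD(1)[OF g(2)] A by blast
    then obtain t where "\<forall>x\<in>A. t x \<in> \<phi> x" by metis
    then show ?thesis unfolding token_branch_def by blast
  qed
  ultimately show ?thesis unfolding connected_graph_def by simp
qed

text \<open>Distinct index sets \<open>A\<close>, \<open>B\<close> of equal size differ in some
  \<open>x\<close> of \<open>A\<close> outside \<open>B\<close>; configurations over
  \<open>A\<close> have a token in \<open>\<phi> x\<close>, those over \<open>B\<close> have none.
  For adjacent \<open>A\<close>, \<open>B\<close> the tokens of the common part are placed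
  identically, and the last one crosses an edge joining the two branch sets.\<close>

lemma minor_model_token:
  "minor_model (token_vertices VH l) (token_edges VH EH l)
     (token_vertices V (l + card W)) (token_edges V E (l + card W)) (token_branch \<phi> W)"
  unfolding minor_model_def
proof (intro conjI ballI impI)
  fix A assume A': "A \<in> token_vertices VH l"
  then have A: "A \<subseteq> VH" "card A = l" by (auto simp: token_vertices_def)
  show "token_branch \<phi> W A \<subseteq> token_vertices V (l + card W)"
    using system(1,2)[OF A(1)] A(2) unfolding token_branch_def token_vertices_def by blast
  show "connected_graph (token_branch \<phi> W A)
      {e \<in> token_edges V E (l + card W). e \<subseteq> token_branch \<phi> W A}"
    by (rule token_branch_connected[OF A])
  fix B assume B': "B \<in> token_vertices VH l" and AB: "A \<noteq> B"
  then have B: "B \<subseteq> VH" "card B = l" by (auto simp: token_vertices_def)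
  have fin: "finite A" "finite B" using A B fH finite_subset by blast+
  have "\<not> A \<subseteq> B" using AB A B fin card_subset_eq by metis
  then obtain x where x: "x \<in> A" "x \<notin> B" by blast
  have "(W \<union> t ` A) \<noteq> (W \<union> t' ` B)" if t: "\<forall>x\<in>A. t x \<in> \<phi> x" "\<forall>x\<in>B. t' x \<in> \<phi> x" for t t'
    using system(4)[OF B(1) t(2), of x] x A(1) t(1) by blast
  then show "token_branch \<phi> W A \<inter> token_branch \<phi> W B = {}" unfolding token_branch_def by blast
  assume "{A, B} \<in> token_edges VH EH l"
  then obtain a b C where C: "A = insert a C" "B = insert b C" "a \<notin> C" "b \<notin> C" "a \<noteq> b" "{a, b} \<in> EH"
    using token_edgesE AB fH by metis
  have ab: "a \<in> VH" "b \<in> VH" "C \<subseteq> VH" using A B C by auto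
  then obtain u v where uv: "u \<in> \<phi> a" "v \<in> \<phi> b" "{u, v} \<in> E" using g(4)[of a b] C by blast
  have "\<forall>x\<in>C. \<exists>u. u \<in> \<phi> x" using connected_graphD(1)[OF g(2)] ab(3) by blast
  then obtain t where t: "\<forall>x\<in>C. t x \<in> \<phi> x" by metis
  have "u \<noteq> v" using g(3)[of a b] ab C(5) uv by blast
  then have "{insert u (W \<union> t ` C), insert v (W \<union> t ` C)} \<in> token_edges V E (Suc (card C) + card W)"
    by (intro token_edge[of _ _ a b] t uv) (use ab C in auto)
  moreover have "Suc (card C) = l" using A(2) C(1,3) fin by simp
  moreover have "insert w (W \<union> t ` C) \<in> token_branch \<phi> W (insert c C)" if "c \<notin> C" "w \<in> \<phi> c" for c w
  proof -
    have "insert w (W \<union> t ` C) = W \<union> (t(c := w)) ` insert c C" using that by (auto simp: image_iff)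
    moreover have "\<forall>x\<in>insert c C. (t(c := w)) x \<in> \<phi> x" using t that by auto
    ultimately show ?thesis unfolding token_branch_def by blast
  qed
  ultimately show "\<exists>u\<in>token_branch \<phi> W A. \<exists>v\<in>token_branch \<phi> W B. {u, v} \<in> token_edges V E (l + card W)"
    using C uv by metis
qed

end

section \<open>Certified minors of small token graphs\<close>

definition edges_of :: "('a \<times> 'a) list \<Rightarrow> 'a set set" where
  "edges_of T = (\<lambda>(a, b). {a, b}) ` set T"

lemma doubleton_in_edges_of_iff: "{a, b} \<in> edges_of T \<longleftrightarrow> (a, b) \<in> set T \<or> (b, a) \<in> set T"
proof
  assume "{a, b} \<in> edges_of T"
  then show "(a, b) \<in> set T \<or> (b, a) \<in> set T"
    unfolding edges_of_def by (auto simp: doubleton_eq_iff)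
next
  assume "(a, b) \<in> set T \<or> (b, a) \<in> set T"
  then show "{a, b} \<in> edges_of T"
    unfolding edges_of_def by (auto intro: rev_image_eqI)
qed

definition token_step :: "(nat \<times> nat) list \<Rightarrow> nat list \<Rightarrow> nat list \<Rightarrow> bool" where
  "token_step T xs ys =
     (case (filter (\<lambda>x. x \<notin> set ys) xs, filter (\<lambda>y. y \<notin> set xs) ys) of
        ([a], [b]) \<Rightarrow> (a, b) \<in> set T \<or> (b, a) \<in> set T
      | _ \<Rightarrow> False)"

text \<open>Connectivity is certified by an order in which every configuration is adjacent to a later one.\<close>

fun grown :: "(nat \<times> nat) list \<Rightarrow> nat list list \<Rightarrow> bool" where
  "grown T [] = False"
| "grown T [x] = True"
| "grown T (x # y # zs) = (list_ex (token_step T x) (y # zs) \<and> grown T (y # zs))"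

text \<open>Configurations are increasing lists, so that equal sets are equal lists and distinctness
  of the lists gives disjointness of the branch sets. The first three entries of \<open>Bs\<close>
  form one side of K_{3,3}, the last three the other.\<close>

definition K33_check :: "(nat \<times> nat) list \<Rightarrow> nat \<Rightarrow> nat \<Rightarrow> nat list list list \<Rightarrow> bool" where
  "K33_check T m l Bs \<longleftrightarrow> length Bs = 6 \<and> distinct (concat Bs) \<and>
     list_all (\<lambda>xs. sorted_wrt (<) xs \<and> length xs = l \<and> list_all (\<lambda>v. v < m) xs) (concat Bs) \<and>
     list_all (grown T) Bs \<and>
     list_all (\<lambda>A. list_all (\<lambda>B. list_ex (\<lambda>x. list_ex (token_step T x) B) A) (drop 3 Bs)) (take 3 Bs)"

lemma token_step_edge:
  assumes "token_step T xs ys"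
    and "length xs = l" "length ys = l" "distinct xs" "distinct ys" "set xs \<subseteq> {..<m}" "set ys \<subseteq> {..<m}"
  shows "{set xs, set ys} \<in> token_edges {..<m} (edges_of T) l"
proof -
  obtain a b where ab: "filter (\<lambda>x. x \<notin> set ys) xs = [a]" "filter (\<lambda>y. y \<notin> set xs) ys = [b]"
      "(a, b) \<in> set T \<or> (b, a) \<in> set T"
    using assms(1) unfolding token_step_def by (auto split: list.splits)
  have "set xs - set ys = {a}" "set ys - set xs = {b}"
    using arg_cong[OF ab(1), of set] arg_cong[OF ab(2), of set] by auto
  then have "set xs - set ys \<union> (set ys - set xs) = {a, b}" by auto
  moreover have "{a, b} \<in> edges_of T" using ab(3) by (simp add: doubleton_in_edges_of_iff)
  moreover have "set xs \<in> token_vertices {..<m} l" "set ys \<in> token_vertices {..<m} l"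
    using assms by (auto simp: token_vertices_def distinct_card)
  ultimately show ?thesis unfolding token_edges_def by blast
qed

lemma grown_connected:
  assumes "grown T xss"
    and "\<And>xs. xs \<in> set xss \<Longrightarrow> length xs = l \<and> distinct xs \<and> set xs \<subseteq> {..<m}"
  shows "connected_graph (set ` set xss)
    {e \<in> token_edges {..<m} (edges_of T) l. e \<subseteq> set ` set xss}"
  using assms
proof (induction T xss rule: grown.induct)
  case (2 T x)
  then show ?case by (simp add: connected_graph_def)
next
  case (3 T x y zs)
  let ?F = "\<lambda>S. {e \<in> token_edges {..<m} (edges_of T) l. e \<subseteq> S}"
  let ?R = "\<lambda>S. {(a, b). {a, b} \<in> ?F S}"
  let ?S = "set ` set (y # zs)" and ?S' = "set ` set (x # y # zs)"
  have con: "connected_graph ?S (?F ?S)" using 3 by simp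
  have mono: "(?R ?S)\<^sup>* \<subseteq> (?R ?S')\<^sup>*" by (rule rtrancl_mono) auto
  obtain z where z: "z \<in> set (y # zs)" "token_step T x z" using "3.prems"(1) by (auto simp: list_ex_iff)
  have "{set x, set z} \<in> token_edges {..<m} (edges_of T) l"
    by (rule token_step_edge[OF z(2)]) (use "3.prems"(2) z(1) in auto)
  then have xz: "(set x, set z) \<in> ?R ?S'" "(set z, set x) \<in> ?R ?S'" using z(1) by (auto simp: insert_commute)
  have zz: "(set z, c) \<in> (?R ?S')\<^sup>*" "(c, set z) \<in> (?R ?S')\<^sup>*" if "c \<in> ?S" for c
    using connected_graphD(2)[OF con, of "set z" c] connected_graphD(2)[OF con, of c "set z"] that z(1) mono
    by blast+
  have c1: "(set z, c) \<in> (?R ?S')\<^sup>*" if "c \<in> ?S'" for c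
    using that zz(1) xz(2) by (cases "c = set x") auto
  have c2: "(c, set z) \<in> (?R ?S')\<^sup>*" if "c \<in> ?S'" for c
    using that zz(2) xz(1) by (cases "c = set x") auto
  show ?case unfolding connected_graph_def
    using c1 c2 by (intro conjI ballI) (simp, meson rtrancl_trans)
qed simp

lemma K33_certificate:
  assumes "K33_check T m l Bs"
  shows "K33_minor (token_vertices {..<m} l) (token_edges {..<m} (edges_of T) l)"
proof -
  have len: "length Bs = 6" and dist: "distinct (concat Bs)"
    and gr: "\<And>i. i < 6 \<Longrightarrow> grown T (Bs ! i)"
    using assms by (auto simp: K33_check_def list_all_length)
  have ok: "length xs = l \<and> distinct xs \<and> set xs \<subseteq> {..<m}" and sorted: "sorted xs"
    if "xs \<in> set (concat Bs)" for xs
    using assms that unfolding K33_check_def list_all_iff strict_sorted_iff by blast+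
  have mem: "xs \<in> set (concat Bs)" if "i < 6" "xs \<in> set (Bs ! i)" for i xs
    using that len by auto
  have uniq: "xs = ys" if "xs \<in> set (concat Bs)" "ys \<in> set (concat Bs)" "set xs = set ys" for xs ys
    using sorted_distinct_set_unique[of xs ys] ok sorted that by simp
  \<comment> \<open>Distinctness of the concatenation would still permit repeated empty blocks;
    \<open>grown\<close> rejects the empty list, so the blocks themselves are distinct.\<close>
  have "[] \<notin> set Bs"
  proof
    assume "[] \<in> set Bs"
    then obtain i where "i < 6" "Bs ! i = []" using len by (auto simp: in_set_conv_nth)
    then show False using gr[of i] by simp
  qed
  then have distB: "distinct Bs" using dist unfolding distinct_concat_iff by simp
  let ?\<phi> = "\<lambda>i. set ` set (Bs ! i)"
  have "minor_model {..<6} {{i, j} | i j. i < 3 \<and> 3 \<le> j \<and> j < 6}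
      (token_vertices {..<m} l) (token_edges {..<m} (edges_of T) l) ?\<phi>"
    unfolding minor_model_def
  proof (intro conjI ballI impI)
    fix i :: nat assume "i \<in> {..<6}"
    then have i: "i < 6" by simp
    show "?\<phi> i \<subseteq> token_vertices {..<m} l"
      using ok[OF mem[OF i]] by (auto simp: token_vertices_def distinct_card)
    show "connected_graph (?\<phi> i) {e \<in> token_edges {..<m} (edges_of T) l. e \<subseteq> ?\<phi> i}"
      by (rule grown_connected[OF gr[OF i]]) (use ok[OF mem[OF i]] in blast)
    fix j :: nat assume "j \<in> {..<6}" and ij: "i \<noteq> j"
    then have j: "j < 6" by simp
    have "set (Bs ! i) \<inter> set (Bs ! j) = {}"
      using dist distB ij i j len unfolding distinct_concat_iff by (metis nth_eq_iff_index_eq nth_mem)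
    then show "?\<phi> i \<inter> ?\<phi> j = {}" using uniq mem[OF i] mem[OF j] by blast
    have edge: "\<exists>x\<in>set (Bs ! p). \<exists>y\<in>set (Bs ! q). {set x, set y} \<in> token_edges {..<m} (edges_of T) l"
      if pq: "p < 3" "3 \<le> q" "q < 6" for p q
    proof -
      have "Bs ! p \<in> set (take 3 Bs)" using pq len by (auto simp: set_conv_nth intro!: exI[of _ p])
      moreover have "Bs ! q \<in> set (drop 3 Bs)" using pq len by (auto simp: set_conv_nth intro!: exI[of _ "q - 3"])
      ultimately obtain x y where xy: "x \<in> set (Bs ! p)" "y \<in> set (Bs ! q)" "token_step T x y"
        using assms unfolding K33_check_def list_all_iff list_ex_iff by blast
      have "{set x, set y} \<in> token_edges {..<m} (edges_of T) l"
        by (rule token_step_edge[OF xy(3)]) (use ok[OF mem[OF _ xy(1)]] ok[OF mem[OF _ xy(2)]] pq in auto)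
      then show ?thesis using xy by blast
    qed
    assume "{i, j} \<in> {{i, j} | i j. i < 3 \<and> 3 \<le> j \<and> j < (6::nat)}"
    then have "i < 3 \<and> 3 \<le> j \<or> j < 3 \<and> 3 \<le> i" by (auto simp: doubleton_eq_iff)
    then show "\<exists>u\<in>?\<phi> i. \<exists>v\<in>?\<phi> j. {u, v} \<in> token_edges {..<m} (edges_of T) l"
    proof
      assume "i < 3 \<and> 3 \<le> j"
      then show ?thesis using edge[of i j] j by simp
    next
      assume "j < 3 \<and> 3 \<le> i"
      then obtain x y where "x \<in> set (Bs ! j)" "y \<in> set (Bs ! i)"
          "{set x, set y} \<in> token_edges {..<m} (edges_of T) l"
        using edge[of j i] i by auto
      then show ?thesis
        by (intro bexI[of _ "set y"] bexI[of _ "set x"]) (simp_all add: insert_commute)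
    qed
  qed
  then show ?thesis unfolding K33_minor_def by blast
qed

text \<open>In the two-token graph of a star each pair of leaves {i,j} is adjacent to just {0,i} and
  {0,j}. With six leaves this is a subdivision of K_6, which contains K_{3,3}; five leaves would
  give a subdivided K_5, which has no K_{3,3} minor.\<close>

lemma K33_minor_star:
  "K33_minor (token_vertices {..<7::nat} 2) (token_edges {..<7} (edges_of [(0,1), (0,2), (0,3), (0,4), (0,5), (0,6)]) 2)"
  by (rule K33_certificate[of _ _ _
      "[[[5,6],[2,6],[4,6],[0,6]], [[3,5],[2,3],[3,4],[0,3]], [[1,5],[1,2],[1,4],[0,1]], [[0,4]], [[0,2]], [[0,5]]]"])
    code_simp

text \<open>Four leaves alone give a subdivided K_4, which is planar; the vertex 5 behind leaf 4
  changes that. Each of the first three branch sets keeps one token on one of the leaves 1, 2, 3;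
  the other side is {0,3}, {0,5}, {0,4}.\<close>

lemma K33_minor_K14_subdivided:
  "K33_minor (token_vertices {..<6::nat} 2) (token_edges {..<6} (edges_of [(0,1), (0,2), (0,3), (0,4), (4,5)]) 2)"
  by (rule K33_certificate[of _ _ _
      "[[[2,5],[2,3],[0,2],[2,4]], [[3,5],[3,4]], [[1,5],[1,3],[0,1],[1,4]], [[0,3]], [[0,5]], [[0,4]]]"])
    code_simp

text \<open>With one token on the claw with centre 0 and leaves 1, 2, 3 and the other on the path 4,
  5, 6, the configurations contain the product of a claw and a path on three vertices. In it {1,5},
  {2,5}, {3,5} are each joined to {0,5} and to the copies of the claw over 4 and over 6.\<close>

lemma K33_minor_spider114:
  "K33_minor (token_vertices {..<7::nat} 2) (token_edges {..<7} (edges_of [(0,1), (0,2), (0,3), (3,4), (4,5), (5,6)]) 2)"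
  by (rule K33_certificate[of _ _ _
      "[[[3,6],[2,6],[1,6],[0,6]], [[0,5]], [[3,4],[2,4],[1,4],[0,4]], [[1,5]], [[2,5]], [[3,5]]]"])
    code_simp

text \<open>Again the product of a path on three vertices and a claw: one token moves on 0, 1, 2,
  while the other two form the claw with centre {4,6} and leaves {5,6}, {3,6}, {4,5}. Each copy of
  the path over a leaf is contracted.\<close>

lemma K33_minor_path:
  "K33_minor (token_vertices {..<7::nat} 3) (token_edges {..<7} (edges_of [(0,1), (1,2), (2,3), (3,4), (4,5), (5,6)]) 3)"
  by (rule K33_certificate[of _ _ _
      "[[[2,5,6],[0,5,6],[1,5,6]], [[2,3,6],[0,3,6],[1,3,6]], [[2,4,5],[0,4,5],[1,4,5]], [[0,4,6]], [[1,4,6]], [[2,4,6]]]"])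
    code_simp

lemma K33_minor_cycle:
  "K33_minor (token_vertices {..<6::nat} 2) (token_edges {..<6} (edges_of [(0,1), (1,2), (2,3), (3,4), (4,5), (5,0)]) 2)"
  by (rule K33_certificate[of _ _ _
      "[[[0,2],[0,3]], [[4,5],[0,4],[1,5],[1,4]], [[3,4],[2,3],[2,4]], [[2,5]], [[1,3]], [[3,5]]]"])
    code_simp

text \<open>The two-token graph of the double star itself is a subdivision of $K_5$; a seventh vertex, attached
  anywhere, is needed to obtain $K_{3,3}$.\<close>

lemma K33_minor_double_star:
  assumes "b < 6"
  shows "K33_minor (token_vertices {..<7::nat} 2)
    (token_edges {..<7} (edges_of ((b, 6) # [(0,1), (0,2), (0,3), (3,4), (3,5)])) 2)"
proof -
  have "K33_minor (token_vertices {..<7::nat} 2)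
      (token_edges {..<7} (edges_of ((0, 6) # [(0,1), (0,2), (0,3), (3,4), (3,5)])) 2)"
    by (rule K33_certificate[of _ _ _
        "[[[0,3]], [[4,6],[1,4],[2,4],[0,4]], [[5,6],[1,5],[2,5],[0,5]], [[2,3]], [[1,3]], [[3,6]]]"])
      code_simp
  moreover
  have "K33_minor (token_vertices {..<7::nat} 2)
      (token_edges {..<7} (edges_of ((1, 6) # [(0,1), (0,2), (0,3), (3,4), (3,5)])) 2)"
    by (rule K33_certificate[of _ _ _
        "[[[0,5],[5,6],[1,5]], [[2,3],[0,2],[1,2],[0,6],[0,1]], [[0,4],[4,6],[1,4]], [[1,3]], [[3,6]], [[0,3]]]"])
      code_simp
  moreover
  have "K33_minor (token_vertices {..<7::nat} 2)
      (token_edges {..<7} (edges_of ((2, 6) # [(0,1), (0,2), (0,3), (3,4), (3,5)])) 2)"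
    by (rule K33_certificate[of _ _ _
        "[[[0,5],[0,4],[1,2],[0,1],[1,3],[0,3]], [[5,6],[4,6],[0,6],[3,6]], [[2,3]], [[0,2]], [[2,4]], [[2,5]]]"])
      code_simp
  moreover
  have "K33_minor (token_vertices {..<7::nat} 2)
      (token_edges {..<7} (edges_of ((3, 6) # [(0,1), (0,2), (0,3), (3,4), (3,5)])) 2)"
    by (rule K33_certificate[of _ _ _
        "[[[1,5],[1,4],[1,6],[1,3]], [[0,3]], [[2,5],[2,4],[2,6],[2,3]], [[0,6]], [[0,4]], [[0,5]]]"])
      code_simp
  moreover
  have "K33_minor (token_vertices {..<7::nat} 2)
      (token_edges {..<7} (edges_of ((4, 6) # [(0,1), (0,2), (0,3), (3,4), (3,5)])) 2)"
    by (rule K33_certificate[of _ _ _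
        "[[[4,5],[3,5],[0,5],[1,3],[2,3],[0,3]], [[3,6],[1,6],[2,6],[0,6]], [[0,4]], [[2,4]], [[1,4]], [[3,4]]]"])
      code_simp
  moreover
  have "K33_minor (token_vertices {..<7::nat} 2)
      (token_edges {..<7} (edges_of ((5, 6) # [(0,1), (0,2), (0,3), (3,4), (3,5)])) 2)"
    by (rule K33_certificate[of _ _ _
        "[[[4,5],[3,4],[0,4],[1,3],[2,3],[0,3]], [[0,5]], [[3,6],[1,6],[2,6],[0,6]], [[2,5]], [[1,5]], [[3,5]]]"])
      code_simp
  moreover have "b = 0 \<or> b = 1 \<or> b = 2 \<or> b = 3 \<or> b = 4 \<or> b = 5" using assms by linarith
  ultimately show ?thesis by (elim disjE) simp_all
qed

section \<open>Connected graphs with a vertex of degree three\<close>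

lemma successively_connected_graph:
  assumes "successively (\<lambda>x y. {x, y} \<in> E) p" "p \<noteq> []"
  shows "connected_graph (set p) {e \<in> E. e \<subseteq> set p}"
  using assms
proof (induction p rule: induct_list012)
  case (2 x)
  then show ?case by (simp add: connected_graph_def)
next
  case (3 x y zs)
  have sub: "connected_graph (set (y # zs)) {e \<in> E. e \<subseteq> set (y # zs)}" using 3 by simp
  \<comment> \<open>The head and the rest of the path are glued as two parts indexed by the truth
    values, joined by the single edge from \<open>x\<close> to \<open>y\<close>.\<close>
  have "connected_graph (\<Union>b\<in>{True, False}. if b then {x} else set (y # zs))
      {e \<in> E. e \<subseteq> (\<Union>b\<in>{True, False}. if b then {x} else set (y # zs))}"
  proof (rule connected_graph_UN)
    have "(True, False) \<in> {(a, b). {a, b} \<in> {e \<in> {{True, False}}. e \<subseteq> {True, False}}}\<^sup>*"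
      "(False, True) \<in> {(a, b). {a, b} \<in> {e \<in> {{True, False}}. e \<subseteq> {True, False}}}\<^sup>*"
      by (auto intro!: r_into_rtrancl)
    then show "connected_graph {True, False} {e \<in> {{True, False}}. e \<subseteq> {True, False}}"
      by (auto simp: connected_graph_def)
  next
    fix b :: bool
    show "connected_graph (if b then {x} else set (y # zs)) {e \<in> E. e \<subseteq> (if b then {x} else set (y # zs))}"
      using sub by (simp add: connected_graph_def)
  next
    fix b c :: bool
    assume "b \<noteq> c"
    moreover have "{x, y} \<in> E" "{y, x} \<in> E" using 3(3) by (auto simp: insert_commute)
    ultimately show "\<exists>u\<in>if b then {x} else set (y # zs). \<exists>v\<in>if c then {x} else set (y # zs). {u, v} \<in> E"
      by auto
  qed
  moreover have "(\<Union>b\<in>{True, False}. if b then {x} else set (y # zs)) = set (x # y # zs)" by auto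
  ultimately show ?case by simp
qed simp

text \<open>In every minor used below the branch sets can be taken to be paths, so a model is a list
  of disjoint vertex lists, the \<open>i\<close>-th being the branch set of vertex
  \<open>i\<close>.\<close>

lemma minor_model_paths:
  assumes dist: "distinct (concat L)" and V: "set (concat L) \<subseteq> V"
    and paths: "\<forall>p\<in>set L. p \<noteq> [] \<and> successively (\<lambda>x y. {x, y} \<in> E) p"
    and T: "\<forall>(a, b)\<in>set T. a < length L \<and> b < length L \<and> (\<exists>u\<in>set (L ! a). \<exists>v\<in>set (L ! b). {u, v} \<in> E)"
  shows "minor_model {..<length L} (edges_of T) V E (\<lambda>i. set (L ! i))"
  unfolding minor_model_def
proof (intro conjI ballI impI)
  fix i assume "i \<in> {..<length L}"
  then have i: "i < length L" by simp
  show "set (L ! i) \<subseteq> V" using V i by force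
  show "connected_graph (set (L ! i)) {e \<in> E. e \<subseteq> set (L ! i)}"
    using paths i by (intro successively_connected_graph) auto
  fix j assume "j \<in> {..<length L}" and ij: "i \<noteq> j"
  then have j: "j < length L" by simp
  have "[] \<notin> set L" using paths by blast
  then have "distinct L" using dist unfolding distinct_concat_iff by simp
  then have "L ! i \<noteq> L ! j" using ij i j nth_eq_iff_index_eq by blast
  then show "set (L ! i) \<inter> set (L ! j) = {}"
    using dist i j unfolding distinct_concat_iff by simp
  assume "{i, j} \<in> edges_of T"
  then have "(i, j) \<in> set T \<or> (j, i) \<in> set T" by (simp add: doubleton_in_edges_of_iff)
  then show "\<exists>u\<in>set (L ! i). \<exists>v\<in>set (L ! j). {u, v} \<in> E"
  proof
    assume "(j, i) \<in> set T"
    then obtain u v where uv: "u \<in> set (L ! j)" "v \<in> set (L ! i)" "{u, v} \<in> E" using T by auto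
    then have "{v, u} \<in> E" by (simp add: insert_commute)
    then show ?thesis using uv by blast
  qed (use T in auto)
qed

text \<open>\<open>l\<close> tokens play on the minor and the other \<open>k - l\<close> are parked
  off the branch sets; the last inequality says that enough vertices are left for them.\<close>

lemma K33_minor_token_paths:
  assumes "finite V"
    and L: "distinct (concat L)" "set (concat L) \<subseteq> V"
      "\<forall>p\<in>set L. p \<noteq> [] \<and> successively (\<lambda>x y. {x, y} \<in> E) p"
      "\<forall>(a, b)\<in>set T. a < length L \<and> b < length L \<and> (\<exists>u\<in>set (L ! a). \<exists>v\<in>set (L ! b). {u, v} \<in> E)"
    and m: "length L = m"
    and H: "K33_minor (token_vertices {..<m} l) (token_edges {..<m} (edges_of T) l)"
    and k: "l \<le> k" "length (concat L) + k \<le> card V + l"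
  shows "K33_minor (token_vertices V k) (token_edges V E k)"
proof -
  have "card (V - set (concat L)) = card V - length (concat L)"
    using card_Diff_subset[OF finite_set L(2)] distinct_card[OF L(1)] by simp
  then have "k - l \<le> card (V - set (concat L))" using k by simp
  then obtain W where W: "W \<subseteq> V - set (concat L)" "card W = k - l" "finite W"
    using obtain_subset_with_card_n by metis
  have "minor_model (token_vertices {..<length L} l) (token_edges {..<length L} (edges_of T) l)
      (token_vertices V (l + card W)) (token_edges V E (l + card W)) (token_branch (\<lambda>i. set (L ! i)) W)"
  proof (rule minor_model_token[OF minor_model_paths[OF L]])
    fix i assume "i \<in> {..<length L}"
    then show "W \<inter> set (L ! i) = {}" using W(1) by auto
  qed (use W in auto)
  moreover have "l + card W = k" using W(2) k(1) by simp
  ultimately show ?thesis using K33_minor_trans[OF _ H] m by simp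
qed

section \<open>Growing a spider in a connected graph\<close>

lemma connected_graph_boundary:
  assumes "connected_graph V E" "simple_graph V E" "U \<subseteq> V" "U \<noteq> {}" "U \<noteq> V"
  shows "\<exists>u\<in>U. \<exists>z\<in>V - U. {u, z} \<in> E"
proof (rule ccontr)
  assume none: "\<not> ?thesis"
  have no: "z \<in> U" if "u \<in> U" "{u, z} \<in> E" for u z
  proof -
    have "z \<in> V" using assms(2) that(2) unfolding simple_graph_def by blast
    then show ?thesis using none that by blast
  qed
  obtain u v where uv: "u \<in> U" "v \<in> V" "v \<notin> U" using assms by blast
  have "(u, v) \<in> {(x, y). {x, y} \<in> E}\<^sup>*" using connected_graphD(2)[OF assms(1)] uv assms(3) by blast
  then have "v \<in> U" by (induction rule: rtrancl_induct) (use uv no in auto)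
  then show False using uv by blast
qed

text \<open>Each leg is listed outwards from the centre \<open>c\<close>, which it does not contain.
  The spider need not be induced: further edges among its vertices are allowed.\<close>

definition spider :: "'a set \<Rightarrow> 'a set set \<Rightarrow> 'a \<Rightarrow> 'a list \<Rightarrow> 'a list \<Rightarrow> 'a list \<Rightarrow> bool" where
  "spider V E c p q r \<longleftrightarrow> p \<noteq> [] \<and> q \<noteq> [] \<and> r \<noteq> [] \<and> distinct (c # p @ q @ r) \<and> set (c # p @ q @ r) \<subseteq> V \<and>
     successively (\<lambda>x y. {x, y} \<in> E) (c # p) \<and> successively (\<lambda>x y. {x, y} \<in> E) (c # q) \<and>
     successively (\<lambda>x y. {x, y} \<in> E) (c # r)"

lemma spider_perm:
  "spider V E c p q r \<Longrightarrow> spider V E c q p r" "spider V E c p q r \<Longrightarrow> spider V E c r q p"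
  by (auto simp: spider_def)

context
  fixes V :: "'a set" and E :: "'a set set" and k :: nat
  assumes simple: "simple_graph V E" and connected: "connected_graph V E"
    and card: "card V > 10" and k: "2 \<le> k" "k + 6 \<le> card V"
begin

private lemma fin: "finite V" using simple by (simp add: simple_graph_def)

private lemma edge: "{x, y} \<in> E \<Longrightarrow> x \<in> V \<and> y \<in> V \<and> x \<noteq> y"
  using simple unfolding simple_graph_def by fastforce

private abbreviation (input) goal where "goal \<equiv> K33_minor (token_vertices V k) (token_edges V E k)"

text \<open>If all vertices other than \<open>c\<close> are its neighbours, there are at least six
  of them and a star is available. Otherwise some vertex \<open>z\<close> lies at distance two,
  behind a neighbour \<open>u\<close>, which together with three further neighbours gives the star
  with one lengthened edge.\<close>

private lemma degree_4:
  assumes N: "N \<subseteq> {x. {c, x} \<in> E}" "card N = 4"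
  shows goal
proof -
  let ?N = "{x. {c, x} \<in> E}"
  have NV: "?N \<subseteq> V" "c \<in> V" "c \<notin> ?N"
  proof -
    show "?N \<subseteq> V" "c \<notin> ?N" using edge by blast+
    have "N \<noteq> {}" using N(2) by auto
    then show "c \<in> V" using edge N(1) by blast
  qed
  have fN: "finite ?N" using NV fin finite_subset by blast
  have pick: "\<exists>xs. distinct xs \<and> length xs = m \<and> set xs \<subseteq> S" if le: "m \<le> card S" for m and S :: "'a set"
  proof -
    obtain X where "X \<subseteq> S" "card X = m" "finite X" using obtain_subset_with_card_n[OF le] by metis
    then show ?thesis using finite_distinct_list distinct_card by metis
  qed
  show ?thesis
  proof (cases "insert c ?N = V")
    case True
    then have "6 \<le> card ?N" using card fN NV(3) card_insert_disjoint[of ?N c] by simp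
    then obtain xs where "distinct xs" "length xs = 6" "set xs \<subseteq> ?N" using pick by blast
    then obtain x1 x2 x3 x4 x5 x6 where x: "distinct [x1, x2, x3, x4, x5, x6]" "{x1, x2, x3, x4, x5, x6} \<subseteq> ?N"
      by (auto simp: length_Suc_conv numeral_eq_Suc)
    show ?thesis
      by (rule K33_minor_token_paths[where L = "[[c], [x1], [x2], [x3], [x4], [x5], [x6]]" and l = 2 and m = 7 and
            T = "[(0,1), (0,2), (0,3), (0,4), (0,5), (0,6)]"])
        (use x NV fin k K33_minor_star in auto)
  next
    case False
    then obtain u z where uz: "u \<in> insert c ?N" "z \<in> V - insert c ?N" "{u, z} \<in> E"
      using connected_graph_boundary[OF connected simple, of "insert c ?N"] NV by blast
    then have u: "u \<in> ?N" by auto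
    have "4 \<le> card ?N" using N card_mono[OF fN N(1)] by simp
    then have "3 \<le> card (?N - {u})" using u fN by simp
    then obtain xs where "distinct xs" "length xs = 3" "set xs \<subseteq> ?N - {u}" using pick by blast
    then obtain x1 x2 x3 where x: "distinct [x1, x2, x3]" "{x1, x2, x3} \<subseteq> ?N - {u}"
      by (auto simp: length_Suc_conv numeral_eq_Suc)
    show ?thesis
      by (rule K33_minor_token_paths[where L = "[[c], [x1], [x2], [x3], [u], [z]]" and l = 2 and m = 6 and
            T = "[(0,1), (0,2), (0,3), (0,4), (4,5)]"])
        (use x u uz NV fin k K33_minor_K14_subdivided in auto)
  qed
qed

private lemma spider_long:
  assumes "spider V E c p q r" "length p \<ge> 4"
  shows goal
proof -
  obtain p0 p1 p2 p3 p' where p: "p = p0 # p1 # p2 # p3 # p'"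
    using assms(2) by (auto simp: Suc_le_length_iff numeral_eq_Suc)
  obtain q0 q' r0 r' where qr: "q = q0 # q'" "r = r0 # r'"
    using assms(1) by (auto simp: spider_def neq_Nil_conv)
  show ?thesis
    by (rule K33_minor_token_paths[where L = "[[c], [q0], [r0], [p0], [p1], [p2], [p3]]" and l = 2 and m = 7 and
            T = "[(0,1), (0,2), (0,3), (3,4), (4,5), (5,6)]"])
      (use assms(1) fin k K33_minor_spider114 in \<open>auto simp: spider_def p qr\<close>)
qed

text \<open>Contracting the leg from its first vertex to x gives the double star with centres c and x.\<close>

private lemma spider_branching:
  assumes sp: "spider V E c (p1 @ x # y # p2) q r" and len: "length p1 \<le> 1"
    and w: "w \<notin> set (c # (p1 @ x # y # p2) @ q @ r)" "{x, w} \<in> E"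
  shows goal
proof -
  obtain q0 q' r0 r' where qr: "q = q0 # q'" "r = r0 # r'"
    using sp by (auto simp: spider_def neq_Nil_conv)
  let ?L = "[[c], [q0], [r0], p1 @ [x], [y], [w]]"
  let ?T = "[(0,1), (0,2), (0,3), (3,4), (3,5)] :: (nat \<times> nat) list"
  have dist: "distinct (concat ?L)" using sp w by (auto simp: spider_def qr)
  have wV: "w \<in> V" using edge w(2) by blast
  have LV: "set (concat ?L) \<subseteq> V" using sp wV by (auto simp: spider_def qr)
  have "p1 = [] \<or> (\<exists>a. p1 = [a])" using len by (cases p1) auto
  then have "successively (\<lambda>x y. {x, y} \<in> E) (p1 @ [x]) \<and> (\<exists>u\<in>set (p1 @ [x]). {c, u} \<in> E) \<and> {x, y} \<in> E"
    using sp unfolding spider_def by (elim disjE exE) simp_all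
  then have paths: "\<forall>p\<in>set ?L. p \<noteq> [] \<and> successively (\<lambda>x y. {x, y} \<in> E) p"
    and T: "\<forall>(a, b)\<in>set ?T. a < length ?L \<and> b < length ?L \<and> (\<exists>u\<in>set (?L ! a). \<exists>v\<in>set (?L ! b). {u, v} \<in> E)"
    using sp w(2) by (auto simp: spider_def qr)
  \<comment> \<open>\<open>p1\<close> contributes at most one vertex to the six vertices
    \<open>c\<close>, \<open>q0\<close>, \<open>r0\<close>, \<open>x\<close>, \<open>y\<close>,
    \<open>w\<close>. With the vertex \<open>z\<close> found next there are at most eight, and
    parking \<open>k - 2\<close> tokens requires just \<open>k + 6\<close> vertices.\<close>
  have "length (concat ?L) \<le> 7" using len by simp
  then have "card (set (concat ?L)) < card V" using card card_length[of "concat ?L"] by linarith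
  then have "set (concat ?L) \<noteq> V" by blast
  moreover have "set (concat ?L) \<noteq> {}" by simp
  ultimately obtain u z where uz: "u \<in> set (concat ?L)" "z \<in> V - set (concat ?L)" "{u, z} \<in> E"
    using connected_graph_boundary[OF connected simple LV] by metis
  \<comment> \<open>The attachment point of \<open>z\<close> is beyond control, which is why
    \<open>K33_minor_double_star\<close> covers every \<open>b < 6\<close>.\<close>
  obtain b where b: "b < 6" "u \<in> set (?L ! b)"
  proof -
    obtain l where "l \<in> set ?L" "u \<in> set l" using uz(1) unfolding set_concat by blast
    then obtain i where "i < length ?L" "u \<in> set (?L ! i)" unfolding in_set_conv_nth by blast
    moreover have "length ?L = 6" by simp
    ultimately show ?thesis using that by metis
  qed
  let ?L' = "?L @ [[z]]"
  have nth: "?L' ! i = ?L ! i" if "i < 6" for i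
    using that nth_append[of ?L "[[z]]" i] by simp
  show ?thesis
  proof (rule K33_minor_token_paths[where L = ?L' and T = "(b, 6) # ?T" and l = 2 and m = 7])
    show "distinct (concat ?L')" using dist uz(2) by auto
    show "set (concat ?L') \<subseteq> V" using LV uz(2) by auto
    show "\<forall>p\<in>set ?L'. p \<noteq> [] \<and> successively (\<lambda>x y. {x, y} \<in> E) p" using paths by auto
    have "\<exists>u\<in>set (?L' ! b). \<exists>v\<in>set (?L' ! 6). {u, v} \<in> E"
      using b(2) uz(3) unfolding nth[OF b(1)] by auto
    then show "\<forall>(a, b)\<in>set ((b, 6) # ?T). a < length ?L' \<and> b < length ?L' \<and>
        (\<exists>u\<in>set (?L' ! a). \<exists>v\<in>set (?L' ! b). {u, v} \<in> E)"
      using T b(1) by simp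
    show "K33_minor (token_vertices {..<7::nat} 2) (token_edges {..<7} (edges_of ((b, 6) # ?T)) 2)"
      using K33_minor_double_star[OF b(1)] by simp
    show "length (concat ?L') + k \<le> card V + 2" using len k by simp
  qed (use fin k in auto)
qed

text \<open>At the tip of a leg the new vertex lengthens the leg; at an inner vertex it creates a
  double star. A leg of length at most three has at most one vertex before an inner
  \<open>x\<close>, as required by \<open>spider_branching\<close>.\<close>

private lemma spider_extend:
  assumes sp: "spider V E c p q r" and len: "length p \<le> 3"
    and w: "w \<in> V - set (c # p @ q @ r)" "{x, w} \<in> E" "x \<in> set p"
  shows "goal \<or> (\<exists>p'. spider V E c p' q r \<and> length p < length p')"
proof -
  obtain p1 p2 where p: "p = p1 @ x # p2" using split_list[OF w(3)] by blast
  show ?thesis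
  proof (cases p2)
    case Nil
    have "spider V E c (p @ [w]) q r"
      using sp w unfolding spider_def p Nil
      by (auto simp: successively_append_iff successively_Cons hd_append)
    then show ?thesis by (intro disjI2 exI[of _ "p @ [w]"]) simp
  next
    case (Cons y p3)
    then show ?thesis using spider_branching[of c p1 x y p3 q r w] sp len w unfolding p by simp
  qed
qed

lemma K33_minor_token_claw:
  assumes c: "{c, a} \<in> E" "{c, b} \<in> E" "{c, d} \<in> E" and dist: "distinct [a, b, d]"
  shows "K33_minor (token_vertices V k) (token_edges V E k)"
proof -
  \<comment> \<open>In a spider of maximal size with legs of length at most three, a further vertex cannot be attached to the end of a leg.\<close>
  let ?P = "\<lambda>(c, p, q, r). spider V E c p q r"
  let ?len = "\<lambda>(c, p, q, r). length (c # p @ q @ r)"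
  have "?P (c, [a], [b], [d])"
    using c dist edge by (auto simp: spider_def)
  moreover have "\<forall>s. ?P s \<longrightarrow> ?len s < Suc (card V)"
  proof clarify
    fix c and p q r :: "'a list"
    assume "spider V E c p q r"
    then have "distinct (c # p @ q @ r)" "set (c # p @ q @ r) \<subseteq> V" unfolding spider_def by blast+
    then show "length (c # p @ q @ r) < Suc (card V)" using card_mono[OF fin] distinct_card le_imp_less_Suc by metis
  qed
  ultimately obtain s where "?P s" "\<forall>s'. ?P s' \<longrightarrow> ?len s' \<le> ?len s"
    using ex_has_greatest_nat[of ?P "(c, [a], [b], [d])" ?len "Suc (card V)"] by blast
  moreover obtain c p q r where s: "s = (c, p, q, r)" by (cases s)
  ultimately have sp: "spider V E c p q r"
    and max: "\<And>c' p' q' r'. spider V E c' p' q' r' \<Longrightarrow> length (c' # p' @ q' @ r') \<le> length (c # p @ q @ r)"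
    by auto
  show ?thesis
  proof (cases "length p \<le> 3 \<and> length q \<le> 3 \<and> length r \<le> 3")
    case False
    then have "length p \<ge> 4 \<or> length q \<ge> 4 \<or> length r \<ge> 4" by linarith
    then show ?thesis
      using spider_long[OF sp] spider_long[OF spider_perm(1)[OF sp]] spider_long[OF spider_perm(2)[OF sp]] by blast
  next
    case True
    let ?S = "set (c # p @ q @ r)"
    have "card ?S < card V" using card_length[of "c # p @ q @ r"] True card by simp
    then have "?S \<noteq> V" by blast
    moreover have "?S \<subseteq> V" using sp unfolding spider_def by blast
    moreover have "?S \<noteq> {}" by simp
    ultimately obtain x w where xw: "x \<in> ?S" "w \<in> V - ?S" "{x, w} \<in> E"
      using connected_graph_boundary[OF connected simple] by metis
    consider "x = c" | "x \<in> set p" | "x \<in> set q" | "x \<in> set r" using xw(1) by auto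
    then show ?thesis
    proof cases
      case 1
      have "{hd p, hd q, hd r, w} \<subseteq> {x. {c, x} \<in> E}" "card {hd p, hd q, hd r, w} = 4"
        using sp xw unfolding spider_def 1 by (auto simp: neq_Nil_conv)
      then show ?thesis by (rule degree_4)
    next
      case 2
      then show ?thesis using spider_extend[OF sp _ xw(2,3)] True max by fastforce
    next
      case 3
      have "w \<in> V - set (c # q @ p @ r)" using xw(2) by auto
      then show ?thesis
        using spider_extend[OF spider_perm(1)[OF sp] _ _ xw(3) 3] True max spider_perm(1) by fastforce
    next
      case 4
      have "w \<in> V - set (c # r @ q @ p)" using xw(2) by auto
      then show ?thesis
        using spider_extend[OF spider_perm(2)[OF sp] _ _ xw(3) 4] True max spider_perm(2) by fastforce
    qed
  qed
qed

end

text \<open>Consider a longest path. A vertex off it cannot be attached to an end, so it gives an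
  inner vertex of the path a third neighbour. If the path spans the graph, it either is induced, or
  has a chord joining its ends, which closes a spanning cycle, or has a chord with an inner
  endpoint, which again yields a claw. The cases may overlap; the cycle may have further
  chords.\<close>

lemma connected_graph_trichotomy:
  assumes simple: "simple_graph V E" and connected: "connected_graph V E"
  obtains (claw) c a b d where "{c, a} \<in> E" "{c, b} \<in> E" "{c, d} \<in> E" "distinct [a, b, d]"
  | (path) p where "distinct p" "set p = V"
      "\<And>i j. i < j \<Longrightarrow> j < length p \<Longrightarrow> {p ! i, p ! j} \<in> E \<longleftrightarrow> j = Suc i"
  | (cycle) p where "distinct p" "set p = V" "successively (\<lambda>x y. {x, y} \<in> E) p" "{last p, hd p} \<in> E"
proof -
  have fin: "finite V" using simple by (simp add: simple_graph_def)
  have edge: "x \<in> V \<and> y \<in> V \<and> x \<noteq> y" if "{x, y} \<in> E" for x y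
    using simple that unfolding simple_graph_def by fastforce
  let ?P = "\<lambda>p. p \<noteq> [] \<and> distinct p \<and> set p \<subseteq> V \<and> successively (\<lambda>x y. {x, y} \<in> E) p"
  obtain v where "v \<in> V" using connected by (auto simp: connected_graph_def)
  then have "?P [v]" by simp
  moreover have "\<forall>p. ?P p \<longrightarrow> length p < Suc (card V)"
    using card_mono[OF fin] distinct_card le_imp_less_Suc by metis
  ultimately obtain p where p: "?P p" and max: "\<And>p'. ?P p' \<Longrightarrow> length p' \<le> length p"
    using ex_has_greatest_nat[of ?P "[v]" length "Suc (card V)"] by blast
  have adj: "{p ! i, p ! Suc i} \<in> E" if "Suc i < length p" for i
    using p that by (simp add: successively_conv_nth)
  have neq: "p ! i \<noteq> p ! j" if "i < length p" "j < length p" "i \<noteq> j" for i j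
    using p that nth_eq_iff_index_eq by blast
  have interior: thesis
    if i: "0 < i" "Suc i < length p" and w: "{p ! i, w} \<in> E" "w \<noteq> p ! (i - 1)" "w \<noteq> p ! Suc i" for i w
  proof (rule claw)
    show "{p ! i, p ! (i - 1)} \<in> E" using adj[of "i - 1"] i by (simp add: insert_commute)
    show "{p ! i, p ! Suc i} \<in> E" using adj i by simp
    show "{p ! i, w} \<in> E" by (rule w)
    show "distinct [p ! (i - 1), p ! Suc i, w]" using neq[of "i - 1" "Suc i"] i w by auto
  qed
  show thesis
  proof (cases "set p = V")
    case False
    moreover have "set p \<noteq> {}" "set p \<subseteq> V" using p by auto
    ultimately obtain x w where xw: "x \<in> set p" "w \<in> V - set p" "{x, w} \<in> E"
      using connected_graph_boundary[OF connected simple] by metis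
    obtain i where i: "i < length p" "x = p ! i" using xw(1) by (auto simp: in_set_conv_nth)
    have "i \<noteq> 0"
    proof
      assume "i = 0"
      then have "?P (w # p)" using p xw i by (auto simp: successively_Cons hd_conv_nth insert_commute)
      then have "length (w # p) \<le> length p" by (rule max)
      then show False by simp
    qed
    moreover have "Suc i \<noteq> length p"
    proof
      assume "Suc i = length p"
      then have "x = last p" using p i by (metis diff_Suc_1 last_conv_nth)
      then have "?P (p @ [w])" using p xw by (auto simp: successively_append_iff)
      then have "length (p @ [w]) \<le> length p" by (rule max)
      then show False by simp
    qed
    ultimately have "0 < i" "Suc i < length p" using i by auto
    then show thesis using xw i by (intro interior[of i w]) auto
  next
    case True
    show thesis
    proof (cases "\<exists>i j. i < j \<and> j < length p \<and> j \<noteq> Suc i \<and> {p ! i, p ! j} \<in> E")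
      case False
      then show thesis using path[of p] p True adj by metis
    next
      case chord: True
      then obtain i j where ij: "i < j" "j < length p" "j \<noteq> Suc i" "{p ! i, p ! j} \<in> E" by blast
      show thesis
      proof (cases "i = 0 \<and> Suc j = length p")
        case end': True
        then have "{last p, hd p} \<in> E"
          using ij p by (metis diff_Suc_1 hd_conv_nth insert_commute last_conv_nth)
        then show thesis using cycle[of p] p True by blast
      next
        case False
        \<comment> \<open>The chord does not join both ends: if \<open>i = 0\<close> then
          \<open>j\<close> is an inner position, and otherwise \<open>i\<close> is.\<close>
        show thesis
        proof (cases "i = 0")
          case True
          then have j: "0 < j - 1" "0 < j" "Suc j < length p" "{p ! j, p ! 0} \<in> E"
            using False ij by (auto simp: insert_commute)
          have "p ! 0 \<noteq> p ! (j - 1)" "p ! 0 \<noteq> p ! Suc j"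
            by (rule neq; use j in linarith)+
          then show thesis by (rule interior[OF j(2,3,4)])
        next
          case False
          then show thesis using ij neq[of j "i - 1"] neq[of j "Suc i"]
            by (intro interior[of i "p ! j"]) auto
        qed
      qed
    qed
  qed
qed

section \<open>Planarity of token graphs\<close>

lemma planar_graph_pullback:
  fixes h :: "'a \<Rightarrow> 'b"
  assumes planar: "planar_graph W F" and h: "bij_betw h V W"
    and E: "\<And>e. e \<in> E \<Longrightarrow> e \<subseteq> V \<and> h ` e \<in> F"
  shows "planar_graph V E"
proof -
  obtain f :: "'b \<Rightarrow> complex" and g where fg: "inj_on f W \<and>
      (\<forall>e\<in>F. arc (g e) \<and> {pathstart (g e), pathfinish (g e)} = f ` e \<and> path_image (g e) \<inter> f ` W = f ` e) \<and>
      (\<forall>e\<in>F. \<forall>e'\<in>F. e \<noteq> e' \<longrightarrow> path_image (g e) \<inter> path_image (g e') = f ` (e \<inter> e'))"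
    using planar unfolding planar_graph_def by (elim exE)
  have hV: "h ` V = W" and inj: "inj_on h V" using h by (auto simp: bij_betw_def)
  have "inj_on (f \<circ> h) V" using fg hV inj by (intro comp_inj_on) auto
  moreover have "arc (g (h ` e)) \<and> {pathstart (g (h ` e)), pathfinish (g (h ` e))} = (f \<circ> h) ` e \<and>
      path_image (g (h ` e)) \<inter> (f \<circ> h) ` V = (f \<circ> h) ` e" if "e \<in> E" for e
    using fg E[OF that] unfolding image_comp[symmetric] hV by simp
  moreover have "path_image (g (h ` e)) \<inter> path_image (g (h ` e')) = (f \<circ> h) ` (e \<inter> e')"
    if "e \<in> E" "e' \<in> E" "e \<noteq> e'" for e e'
  proof -
    have "h ` e \<noteq> h ` e'" using inj_on_image_eq_iff[OF inj] E that by blast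
    moreover have "h ` (e \<inter> e') = h ` e \<inter> h ` e'" using inj_on_image_Int[OF inj] E that by blast
    ultimately show ?thesis using fg E that unfolding image_comp[symmetric] by simp
  qed
  ultimately show ?thesis unfolding planar_graph_def
    by (intro exI[of _ "f \<circ> h"] exI[of _ "\<lambda>e. g (h ` e)"]) simp
qed

lemma token_edgesD:
  assumes "e \<in> token_edges V E k"
  obtains A B a b where "e = {A, B}" "A \<in> token_vertices V k" "B \<in> token_vertices V k"
    "(A - B) \<union> (B - A) = {a, b}" "{a, b} \<in> E"
  using assms unfolding token_edges_def mem_Collect_eq by (elim exE conjE) (rule that)

lemma simple_graph_token:
  assumes "finite V"
  shows "simple_graph (token_vertices V k) (token_edges V E k)"
  unfolding simple_graph_def
proof (intro conjI ballI)
  show "finite (token_vertices V k)"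
    unfolding token_vertices_def by (rule finite_subset[of _ "Pow V"]) (use assms in auto)
  fix e assume "e \<in> token_edges V E k"
  then obtain A B a b where e: "e = {A, B}" "A \<in> token_vertices V k" "B \<in> token_vertices V k"
    "(A - B) \<union> (B - A) = {a, b}" by (rule token_edgesD)
  then have "A \<noteq> B" by auto
  then show "card e = 2" "e \<subseteq> token_vertices V k" using e by auto
qed

text \<open>Two complements have the same symmetric difference as the sets themselves, so exchanging
  tokens and free vertices preserves adjacency.\<close>

lemma planar_token_complement:
  assumes "finite V" "k \<le> card V" "planar_graph (token_vertices V (card V - k)) (token_edges V E (card V - k))"
  shows "planar_graph (token_vertices V k) (token_edges V E k)"
proof (rule planar_graph_pullback[OF assms(3)])
  let ?h = "\<lambda>A. V - A"
  have card: "card (V - A) = card V - card A" if "A \<subseteq> V" for A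
    using card_Diff_subset[of A V] that assms(1) finite_subset by blast
  have vert: "V - A \<in> token_vertices V (card V - k)" if "A \<in> token_vertices V k" for A
    using that card by (auto simp: token_vertices_def)
  show "bij_betw ?h (token_vertices V k) (token_vertices V (card V - k))"
  proof (rule bij_betw_byWitness[where f' = ?h])
    show "?h ` token_vertices V (card V - k) \<subseteq> token_vertices V k"
      using card assms(2) by (auto simp: token_vertices_def)
  qed (use vert in \<open>auto simp: token_vertices_def\<close>)
  fix e assume "e \<in> token_edges V E k"
  then obtain A B a b where e: "e = {A, B}" "A \<in> token_vertices V k" "B \<in> token_vertices V k"
    "(A - B) \<union> (B - A) = {a, b}" "{a, b} \<in> E" by (rule token_edgesD)
  have "((V - A) - (V - B)) \<union> ((V - B) - (V - A)) = (A - B) \<union> (B - A)"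
    using e(2,3) by (auto simp: token_vertices_def)
  then have "?h ` e \<in> token_edges V E (card V - k)"
    using vert e unfolding token_edges_def by auto
  then show "e \<subseteq> token_vertices V k \<and> ?h ` e \<in> token_edges V E (card V - k)" using e by simp
qed

lemma planar_token_iso:
  assumes f: "bij_betw f V W" and E: "\<And>u v. u \<in> V \<Longrightarrow> v \<in> V \<Longrightarrow> {u, v} \<in> E \<Longrightarrow> {f u, f v} \<in> F"
    and planar: "planar_graph (token_vertices W k) (token_edges W F k)"
  shows "planar_graph (token_vertices V k) (token_edges V E k)"
proof (rule planar_graph_pullback[OF planar])
  have fV: "f ` V = W" and inj: "inj_on f V" using f by (auto simp: bij_betw_def)
  have card: "card (f ` A) = card A" if "A \<subseteq> V" for A
    using card_image inj_on_subset[OF inj that] by blast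
  show "bij_betw (image f) (token_vertices V k) (token_vertices W k)"
    unfolding bij_betw_def
  proof
    show "inj_on (image f) (token_vertices V k)"
      by (rule inj_on_subset[OF inj_on_image_Pow[OF inj]]) (auto simp: token_vertices_def)
    show "image f ` token_vertices V k = token_vertices W k"
    proof
      show "image f ` token_vertices V k \<subseteq> token_vertices W k"
        using card fV by (auto simp: token_vertices_def)
      show "token_vertices W k \<subseteq> image f ` token_vertices V k"
      proof
        fix B assume "B \<in> token_vertices W k"
        then obtain A where "A \<subseteq> V" "B = f ` A" "card B = k"
          unfolding token_vertices_def fV[symmetric] by (auto simp: subset_image_iff)
        then show "B \<in> image f ` token_vertices V k" using card by (auto simp: token_vertices_def)
      qed
    qed
  qed
  fix e assume "e \<in> token_edges V E k"
  then obtain A B a b where e: "e = {A, B}" "A \<in> token_vertices V k" "B \<in> token_vertices V k"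
    "(A - B) \<union> (B - A) = {a, b}" "{a, b} \<in> E" by (rule token_edgesD)
  have AB: "A \<subseteq> V" "B \<subseteq> V" "card A = k" "card B = k" using e by (auto simp: token_vertices_def)
  have "f ` A - f ` B = f ` (A - B)" "f ` B - f ` A = f ` (B - A)"
    using inj_on_image_set_diff[OF inj, of A B] inj_on_image_set_diff[OF inj, of B A] AB by blast+
  then have "(f ` A - f ` B) \<union> (f ` B - f ` A) = {f a, f b}" using e(4) by (simp flip: image_Un)
  moreover have "a \<in> V" "b \<in> V" using e(4) AB by blast+
  then have "{f a, f b} \<in> F" using E e(5) by blast
  moreover have "f ` A \<in> token_vertices W k" "f ` B \<in> token_vertices W k"
    using AB card fV by (auto simp: token_vertices_def)
  ultimately have "{f ` A, f ` B} \<in> token_edges W F k" unfolding token_edges_def by blast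
  then show "e \<subseteq> token_vertices V k \<and> image f ` e \<in> token_edges W F k" using e by simp
qed

lemma unit_segment:
  fixes a :: complex
  assumes a: "Re a \<in> \<int>" "Im a \<in> \<int>" and b: "b = a + 1 \<or> b = a + \<i>" and z: "z \<in> closed_segment a b"
  shows "z \<in> {a, b} \<or> \<not> (Re z \<in> \<int> \<and> Im z \<in> \<int>) \<and>
    {Complex \<lfloor>Re z\<rfloor> \<lfloor>Im z\<rfloor>, Complex \<lceil>Re z\<rceil> \<lceil>Im z\<rceil>} = {a, b}"
proof (cases "z \<in> {a, b}")
  case False
  obtain x y :: int where xy: "Re a = x" "Im a = y" using a by (auto elim!: Ints_cases)
  obtain t where t: "0 \<le> t" "t \<le> 1" "z = (1 - t) *\<^sub>R a + t *\<^sub>R b" using z by (auto simp: closed_segment_def)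
  then have "t \<noteq> 0" "t \<noteq> 1" using False by auto
  then have t01: "0 < t" "t < 1" using t by auto
  have frac: "\<lfloor>real_of_int m + t\<rfloor> = m" "\<lceil>real_of_int m + t\<rceil> = m + 1" for m
    using t01 by (auto simp: floor_eq_iff ceiling_eq_iff)
  have nonint: "real_of_int m + t \<notin> \<int>" for m
    using frac[of m] t01 by (metis Ints_cases add_cancel_left_right floor_of_int less_irrefl)
  from b show ?thesis
  proof
    assume b: "b = a + 1"
    then have "Re z = x + t" "Im z = y" using t(3) xy by (auto simp: algebra_simps)
    then show ?thesis using frac nonint b xy by (auto simp: complex_eq_iff)
  next
    assume b: "b = a + \<i>"
    then have "Re z = x" "Im z = y + t" using t(3) xy by (auto simp: algebra_simps)
    then show ?thesis using frac nonint b xy by (auto simp: complex_eq_iff)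
  qed
qed simp

lemma planar_lattice_graph:
  fixes f :: "'a \<Rightarrow> complex"
  assumes inj: "inj_on f V" and lat: "\<And>v. v \<in> V \<Longrightarrow> Re (f v) \<in> \<int> \<and> Im (f v) \<in> \<int>"
    and E: "\<And>e. e \<in> E \<Longrightarrow> \<exists>u v. e = {u, v} \<and> u \<in> V \<and> v \<in> V \<and> (f v = f u + 1 \<or> f v = f u + \<i>)"
  shows "planar_graph V E"
proof -
  obtain s t where st: "\<And>e. e \<in> E \<Longrightarrow> e = {s e, t e} \<and> s e \<in> V \<and> t e \<in> V \<and> (f (t e) = f (s e) + 1 \<or> f (t e) = f (s e) + \<i>)"
    using E by metis
  let ?g = "\<lambda>e. linepath (f (s e)) (f (t e))"
  have fe: "f ` e = {f (s e), f (t e)}" and eV: "e \<subseteq> V" if "e \<in> E" for e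
    using st[OF that] by (metis image_empty image_insert, metis empty_subsetI insert_subset)
  have on: "z \<in> f ` e \<or> \<not> (Re z \<in> \<int> \<and> Im z \<in> \<int>) \<and> {Complex \<lfloor>Re z\<rfloor> \<lfloor>Im z\<rfloor>, Complex \<lceil>Re z\<rceil> \<lceil>Im z\<rceil>} = f ` e"
    if "e \<in> E" "z \<in> path_image (?g e)" for e z
    unfolding fe[OF that(1)] by (rule unit_segment) (use st[OF that(1)] lat that(2) in auto)
  have sub: "f ` e \<subseteq> path_image (?g e)" if "e \<in> E" for e unfolding fe[OF that] by simp
  have "arc (?g e)" if "e \<in> E" for e using st[OF that] by (intro arc_linepath) (auto simp: complex_eq_iff)
  moreover have "path_image (?g e) \<inter> f ` V = f ` e" if "e \<in> E" for e
  proof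
    show "path_image (?g e) \<inter> f ` V \<subseteq> f ` e"
    proof
      fix z assume "z \<in> path_image (?g e) \<inter> f ` V"
      then show "z \<in> f ` e" using on[OF that] lat by auto
    qed
    show "f ` e \<subseteq> path_image (?g e) \<inter> f ` V" using sub[OF that] eV[OF that] by blast
  qed
  moreover have "path_image (?g e) \<inter> path_image (?g e') = f ` (e \<inter> e')" if e: "e \<in> E" "e' \<in> E" "e \<noteq> e'" for e e'
  proof
    have int: "f ` (e \<inter> e') = f ` e \<inter> f ` e'" by (rule inj_on_image_Int[OF inj eV[OF e(1)] eV[OF e(2)]])
    then show "f ` (e \<inter> e') \<subseteq> path_image (?g e) \<inter> path_image (?g e')" using sub e by blast
    have ne: "f ` e \<noteq> f ` e'" using inj_on_image_eq_iff[OF inj eV[OF e(1)] eV[OF e(2)]] e(3) by simp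
    show "path_image (?g e) \<inter> path_image (?g e') \<subseteq> f ` (e \<inter> e')"
    proof
      fix z assume z: "z \<in> path_image (?g e) \<inter> path_image (?g e')"
      have "z \<in> f ` e \<and> z \<in> f ` e'"
      proof (rule ccontr)
        assume "\<not> ?thesis"
        moreover have "Re z \<in> \<int> \<and> Im z \<in> \<int>" if "z \<in> f ` e \<or> z \<in> f ` e'"
          using that lat eV e by blast
        ultimately show False using on[OF e(1), of z] on[OF e(2), of z] z ne by blast
      qed
      then show "z \<in> f ` (e \<inter> e')" unfolding int by blast
    qed
  qed
  ultimately show ?thesis unfolding planar_graph_def
    using inj fe by (intro exI[of _ f] exI[of _ ?g]) simp
qed

text \<open>The smaller and the larger token position serve as coordinates. Sliding a token by one
  step changes one coordinate by one, so every edge becomes a unit segment; it is oriented from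
  position \<open>i\<close> to \<open>Suc i\<close> to point right or up.\<close>

lemma planar_token_path: "planar_graph (token_vertices (path_vertices n) 2) (token_edges (path_vertices n) (path_edges n) 2)"
proof -
  let ?f = "\<lambda>A::nat set. Complex (Min A) (Max A)"
  have pair: "A = {Min A, Max A}" if A: "A \<in> token_vertices (path_vertices n) 2" for A
  proof -
    obtain x y where "A = {x, y}" "x \<noteq> y" using A by (auto simp: token_vertices_def card_2_iff)
    then show ?thesis by (cases "x < y") (auto simp: min_def max_def)
  qed
  show ?thesis
  proof (rule planar_lattice_graph[of ?f])
    show "inj_on ?f (token_vertices (path_vertices n) 2)"
    proof (rule inj_onI)
      fix A B assume "A \<in> token_vertices (path_vertices n) 2" "B \<in> token_vertices (path_vertices n) 2" "?f A = ?f B"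
      then show "A = B" using pair[of A] pair[of B] by simp
    qed
    fix e assume "e \<in> token_edges (path_vertices n) (path_edges n) 2"
    then obtain A B a b where e: "e = {A, B}" "A \<in> token_vertices (path_vertices n) 2"
      "B \<in> token_vertices (path_vertices n) 2"
      and ab: "(A - B) \<union> (B - A) = {a, b}" by (rule token_edgesD)
    have "A \<noteq> B" using ab by auto
    moreover have "finite (path_vertices n)" by (simp add: path_vertices_def)
    ultimately obtain a b C where C: "A = insert a C" "B = insert b C" "a \<notin> C" "b \<notin> C" "{a, b} \<in> path_edges n"
      using token_edgesE[of A B] \<open>e \<in> _\<close> e(1) by metis
    have "\<exists>A B C i. e = {A, B} \<and> A = insert i C \<and> B = insert (Suc i) C \<and> i \<notin> C \<and> Suc i \<notin> C \<and>
        A \<in> token_vertices (path_vertices n) 2 \<and> B \<in> token_vertices (path_vertices n) 2"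
    proof -
      obtain i where "a = i \<and> b = Suc i \<or> a = Suc i \<and> b = i"
        using C(5) by (auto simp: path_edges_def doubleton_eq_iff)
      then show ?thesis
      proof
        assume "a = i \<and> b = Suc i"
        then show ?thesis using C e by (intro exI[of _ A] exI[of _ B] exI[of _ C] exI[of _ i]) simp
      next
        assume "a = Suc i \<and> b = i"
        then show ?thesis using C e
          by (intro exI[of _ B] exI[of _ A] exI[of _ C] exI[of _ i]) (simp add: insert_commute)
      qed
    qed
    then obtain A B C i where AB: "e = {A, B}" "A = insert i C" "B = insert (Suc i) C" "i \<notin> C" "Suc i \<notin> C"
        "A \<in> token_vertices (path_vertices n) 2" "B \<in> token_vertices (path_vertices n) 2" by blast
    have "finite A" "card A = 2" using AB(6) by (auto simp: token_vertices_def path_vertices_def finite_subset)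
    then have "card C = 1" using AB(2,4) by simp
    then obtain c where c: "C = {c}" by (rule card_1_singletonE)
    \<comment> \<open>The resting token \<open>c\<close> is neither at \<open>i\<close> nor at
      \<open>Suc i\<close>, so it lies on the same side of the moving token before and after the
      slide; tokens never overtake each other.\<close>
    have "?f B = ?f A + 1 \<or> ?f B = ?f A + \<i>"
      using AB(4,5) unfolding AB(2,3) c by (cases "c < i") (auto simp: complex_eq_iff min_def max_def)
    then show "\<exists>u v. e = {u, v} \<and> u \<in> token_vertices (path_vertices n) 2 \<and>
        v \<in> token_vertices (path_vertices n) 2 \<and> (?f v = ?f u + 1 \<or> ?f v = ?f u + \<i>)"
      using AB by blast
  qed simp
qed

section \<open>Spanning paths, spanning cycles and the equivalence\<close>

lemma graph_iso_pathI:
  assumes "distinct p" "set p = V" "\<And>e. e \<in> E \<Longrightarrow> card e = 2"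
    and adj: "\<And>i j. i < j \<Longrightarrow> j < length p \<Longrightarrow> {p ! i, p ! j} \<in> E \<longleftrightarrow> j = Suc i"
  shows "graph_iso V E (path_vertices (length p)) (path_edges (length p))"
proof -
  let ?f = "the_inv_into {0..<length p} ((!) p)"
  have bij: "bij_betw ((!) p) {0..<length p} V"
    by (rule bij_betw_nth) (use assms in auto)
  have inj: "inj_on ((!) p) {0..<length p}" using bij by (simp add: bij_betw_def)
  have fp: "?f (p ! i) = i" if "i < length p" for i
    using the_inv_into_f_f[OF inj] that by simp
  have path: "{i, j} \<in> path_edges (length p) \<longleftrightarrow> j < length p \<and> i < length p \<and> (j = Suc i \<or> i = Suc j)" for i j
    by (auto simp: path_edges_def doubleton_eq_iff)
  have "{p ! i, p ! j} \<in> E \<longleftrightarrow> {i, j} \<in> path_edges (length p)" if ij: "i < length p" "j < length p" for i j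
  proof -
    consider "i < j" | "j < i" | "i = j" by linarith
    then show ?thesis
    proof cases
      case 3
      have "{p ! i} \<notin> E" using assms(3) by force
      then show ?thesis using 3 path[of i i] by simp
    qed (use adj[of i j] adj[of j i] ij path in \<open>auto simp: insert_commute\<close>)
  qed
  moreover have "\<exists>i<length p. u = p ! i" if "u \<in> V" for u
    using that assms(2) by (auto simp: in_set_conv_nth)
  ultimately have "{u, v} \<in> E \<longleftrightarrow> {?f u, ?f v} \<in> path_edges (length p)" if "u \<in> V" "v \<in> V" for u v
    using fp that by metis
  moreover have "bij_betw ?f V (path_vertices (length p))"
    unfolding path_vertices_def by (rule bij_betw_the_inv_into[OF bij])
  ultimately show ?thesis unfolding graph_iso_def by blast
qed

lemma K33_minor_token_long_path:
  assumes "finite V" "distinct p" "set p \<subseteq> V" "successively (\<lambda>x y. {x, y} \<in> E) p" "7 \<le> length p"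
    and k: "3 \<le> k" "k + 4 \<le> card V"
  shows "K33_minor (token_vertices V k) (token_edges V E k)"
proof -
  obtain x0 x1 x2 x3 x4 x5 x6 q where p: "p = x0 # x1 # x2 # x3 # x4 # x5 # x6 # q"
    using assms(5) by (auto simp: Suc_le_length_iff numeral_eq_Suc)
  show ?thesis
    by (rule K33_minor_token_paths[where L = "[[x0], [x1], [x2], [x3], [x4], [x5], [x6]]" and l = 3 and m = 7 and
          T = "[(0,1), (1,2), (2,3), (3,4), (4,5), (5,6)]"])
      (use assms K33_minor_path in \<open>auto simp: p\<close>)
qed

text \<open>Everything from the sixth vertex on is contracted into one vertex of C_6. The branch
  sets use up all of \<open>V\<close>, which leaves no room for parking; so the claim is made for
  two tokens only.\<close>

lemma K33_minor_token_cycle: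
  assumes "finite V" "distinct p" "set p = V" "successively (\<lambda>x y. {x, y} \<in> E) p" "{last p, hd p} \<in> E"
    and "6 \<le> card V"
  shows "K33_minor (token_vertices V 2) (token_edges V E 2)"
proof -
  have len: "length p = card V" using distinct_card[OF assms(2)] assms(3) by simp
  obtain x0 x1 x2 x3 x4 x5 q where p: "p = x0 # x1 # x2 # x3 # x4 # x5 # q"
    using assms(6) unfolding len[symmetric] by (auto simp: Suc_le_length_iff numeral_eq_Suc)
  have last: "last p \<in> set (x5 # q)" by (simp add: p)
  show ?thesis
  proof (rule K33_minor_token_paths[where L = "[[x0], [x1], [x2], [x3], [x4], x5 # q]" and l = 2 and m = 6 and
          T = "[(0,1), (1,2), (2,3), (3,4), (4,5), (5,0)]"])
    have "\<exists>u\<in>set (x5 # q). {u, x0} \<in> E" using last assms(5) by (auto simp: p)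
    then show "\<forall>(a, b)\<in>set [(0,1), (1,2), (2,3), (3,4), (4,5), (5,0)].
        a < length [[x0], [x1], [x2], [x3], [x4], x5 # q] \<and> b < length [[x0], [x1], [x2], [x3], [x4], x5 # q] \<and>
        (\<exists>u\<in>set ([[x0], [x1], [x2], [x3], [x4], x5 # q] ! a). \<exists>v\<in>set ([[x0], [x1], [x2], [x3], [x4], x5 # q] ! b). {u, v} \<in> E)"
      using assms(4) by (simp add: p)
    show "K33_minor (token_vertices {..<6::nat} 2)
        (token_edges {..<6} (edges_of [(0,1), (1,2), (2,3), (3,4), (4,5), (5,0)]) 2)"
      by (rule K33_minor_cycle)
  qed (use assms len in \<open>auto simp: p\<close>)
qed

theorem theorem2:
  fixes V :: "'a set" and E :: "'a set set" and n k :: nat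
  assumes "simple_graph V E" and "connected_graph V E"
    and "card V = n" and "n > 10"
    and "2 \<le> k" and "k \<le> n - 2"
  shows "planar_graph (token_vertices V k) (token_edges V E k) \<longleftrightarrow>
           ((k = 2 \<or> k = n - 2) \<and> graph_iso V E (path_vertices n) (path_edges n))"
proof
  have fin: "finite V" using assms(1) by (simp add: simple_graph_def)
  {
    assume planar: "planar_graph (token_vertices V k) (token_edges V E k)"
    \<comment> \<open>Passing to the complement makes \<open>2 * l \<le> n\<close>; with
      \<open>n \<ge> 11\<close> this yields the parking room \<open>l + 6 \<le> n\<close>. In both
      cases \<open>l = 2\<close> translates back to \<open>k = 2\<close> or
      \<open>k = n - 2\<close>.\<close>
    define l where "l = (if 2 * k \<le> n then k else n - k)"
    have l: "2 \<le> l" "l + 6 \<le> n" "l = 2 \<Longrightarrow> k = 2 \<or> k = n - 2"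
      using assms(4-6) by (auto simp: l_def split: if_splits)
    have "planar_graph (token_vertices V l) (token_edges V E l)"
    proof (cases "2 * k \<le> n")
      case False
      then show ?thesis
        using planar_token_complement[OF fin, of "n - k" E] planar assms(3,6) by (simp add: l_def)
    qed (use planar in \<open>simp add: l_def\<close>)
    then have no: "\<not> K33_minor (token_vertices V l) (token_edges V E l)"
      using planar_graph_no_K33_minor simple_graph_token[OF fin] by blast
    \<comment> \<open>With three or more tokens, seven consecutive vertices of a spanning path
      already give the minor. This settles the path case and reduces the cycle case to two
      tokens.\<close>
    have short: "l = 2" if "distinct p" "set p = V" "successively (\<lambda>x y. {x, y} \<in> E) p" for p
    proof (rule ccontr)
      assume "l \<noteq> 2"
      then show False
        using no K33_minor_token_long_path[OF fin that(1) _ that(3), of l] that(2) l assms(3,4)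
          distinct_card[OF that(1)] by simp
    qed
    from assms(1,2) show "(k = 2 \<or> k = n - 2) \<and> graph_iso V E (path_vertices n) (path_edges n)"
    proof (cases rule: connected_graph_trichotomy)
      case (claw c a b d)
      then show ?thesis using no K33_minor_token_claw[OF assms(1,2)] assms(3,4) l by blast
    next
      case (path p)
      have "successively (\<lambda>x y. {x, y} \<in> E) p" using path(3) by (simp add: successively_conv_nth)
      then have "l = 2" using short path by blast
      moreover have "length p = n" using path distinct_card assms(3) by metis
      moreover have "card e = 2" if "e \<in> E" for e using assms(1) that by (simp add: simple_graph_def)
      ultimately show ?thesis using graph_iso_pathI[OF path(1,2) _ path(3)] l(3) by simp
    next
      case (cycle p)
      then have "l = 2" using short by blast
      then show ?thesis using no K33_minor_token_cycle[OF fin cycle] assms(3,4) by simp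
    qed
  }
  assume R: "(k = 2 \<or> k = n - 2) \<and> graph_iso V E (path_vertices n) (path_edges n)"
  then obtain f where f: "bij_betw f V (path_vertices n)"
      "\<And>u v. u \<in> V \<Longrightarrow> v \<in> V \<Longrightarrow> {u, v} \<in> E \<longleftrightarrow> {f u, f v} \<in> path_edges n"
    unfolding graph_iso_def by blast
  have "planar_graph (token_vertices V 2) (token_edges V E 2)"
    by (rule planar_token_iso[OF f(1) _ planar_token_path]) (use f(2) in blast)
  \<comment> \<open>For \<open>k = n - 2\<close> the complement of a configuration has
    \<open>n - (n - 2) = 2\<close> tokens.\<close>
  then show "planar_graph (token_vertices V k) (token_edges V E k)"
    using R planar_token_complement[OF fin, of "n - 2" E] assms(3,4) by auto
qed

end
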